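(* Let $n\ge2$ and let $\Theta_n^u$ be the differential operator defined in the context. Then the coefficients of $\Theta_n^u[y]$, as a linear differential expression in $y$, depend only on $\mathfrak{q}$ and its derivatives (they do not involve $u$ or $u'$), and $\Theta_n^u$ generates the most general form of the $n$th-order linear iterative equation in normal form: a linear equation $$y^{(n)}+A_n^2\,y^{(n-2)}+\dots+A_n^n\,y=0$$ is iterative if and only if it is the equation $\Theta_n^u[y]=0$ for some function $\mathfrak{q}=\mathfrak{q}(x)$.
   Context: All functions are smooth functions of $x$ and all considerations are local (on sufficiently small intervals). Superscripts on $A_n^j$ are indices, not powers. Two equations differing by multiplication by a nowhere vanishing function of $x$ are regarded as the same equation. Iterative equations: let $r$ (nowhere zero) and $s$ be smooth functions of $x$, and let $\Psi=r\frac{d}{dx}+s$, so $\Psi[y]=ry'+sy$. Put $\Psi^0=I$ (identity) and $\Psi^n[y]=\Psi^{n-1}(\Psi[y])$ for $n\ge1$. A linear equation of order $n$ is called iterative if it is of the form $\Psi^n[y]=0$ for some such $r,s$. The operator $\Phi_n$: write $\Psi^n[y]=K_n^0y^{(n)}+K_n^1y^{(n-1)}+\dots+K_n^ny$, where $K_n^0=r^n$. The condition $K_n^1=0$ is equivalent to $s=-\frac12(n-1)r'$. The operator $\Phi_n$ is $\frac{1}{r^n}\Psi^n$ with $s=-\frac12(n-1)r'$; its coefficients are expressions in $r$ and its derivatives. The operator $\Theta_n^u$: it is obtained from $\Phi_n$ by replacing $r$ with $u^2$, where $u$ is a nowhere vanishing function, and then eliminating all derivatives of $u$ of order at least two by means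 of the relation $u''=-\mathfrak{q}u$ and its differential consequences $u^{(j)}=D_x^{j-2}(-u\mathfrak{q})$, $j\ge2$, where $D_x=d/dx$ (applied repeatedly until only $u$, $u'$ and $\mathfrak{q}$ and its derivatives remain), with $\mathfrak{q}$ a function of $x$. Thus $u$ is a solution of $y''+\mathfrak{q}y=0$. *)

theory Defs
  imports "HOL-Analysis.Analysis"
begin

section \<open>Formal differential expressions\<close>

text \<open>
  Rational differential expressions with real constants. Two expressions are regarded as the same
  if they have the same value for all values of the variables for which the denominators
  do not vanish.
\<close>

datatype 'v dexpr =
    Const real
  | Var 'v
  | Add "'v dexpr" "'v dexpr"
  | Mul "'v dexpr" "'v dexpr"
  | Inv "'v dexpr"

primrec dpow :: "'v dexpr \<Rightarrow> nat \<Rightarrow> 'v dexpr" where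
  "dpow e 0 = Const 1"
| "dpow e (Suc k) = Mul e (dpow e k)"

primrec dval :: "('v \<Rightarrow> real) \<Rightarrow> 'v dexpr \<Rightarrow> real" where
  "dval \<rho> (Const c) = c"
| "dval \<rho> (Var v) = \<rho> v"
| "dval \<rho> (Add a b) = dval \<rho> a + dval \<rho> b"
| "dval \<rho> (Mul a b) = dval \<rho> a * dval \<rho> b"
| "dval \<rho> (Inv a) = inverse (dval \<rho> a)"

primrec dsubst :: "('v \<Rightarrow> 'w dexpr) \<Rightarrow> 'v dexpr \<Rightarrow> 'w dexpr" where
  "dsubst \<sigma> (Const c) = Const c"
| "dsubst \<sigma> (Var v) = \<sigma> v"
| "dsubst \<sigma> (Add a b) = Add (dsubst \<sigma> a) (dsubst \<sigma> b)"
| "dsubst \<sigma> (Mul a b) = Mul (dsubst \<sigma> a) (dsubst \<sigma> b)"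
| "dsubst \<sigma> (Inv a) = Inv (dsubst \<sigma> a)"

text \<open>
  The variable \<open>(f, k)\<close> stands for the \<open>k\<close>-th derivative of the unknown function \<open>f\<close>.
\<close>

datatype unknown = R | U | Q | Y

type_synonym dvar = "unknown \<times> nat"

primrec Dx :: "dvar dexpr \<Rightarrow> dvar dexpr" where
  "Dx (Const c) = Const 0"
| "Dx (Var v) = Var (fst v, Suc (snd v))"
| "Dx (Add a b) = Add (Dx a) (Dx b)"
| "Dx (Mul a b) = Add (Mul (Dx a) b) (Mul a (Dx b))"
| "Dx (Inv a) = Mul (Const (-1)) (Mul (Dx a) (Inv (Mul a a)))"


section \<open>The operators \<open>\<Phi>\<^sub>n\<close> and \<open>\<Theta>\<^sub>n\<^sup>u\<close>\<close>

definition Psi_expr :: "dvar dexpr \<Rightarrow> dvar dexpr \<Rightarrow> dvar dexpr \<Rightarrow> dvar dexpr" where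
  "Psi_expr r s e = Add (Mul r (Dx e)) (Mul s e)"

definition Phi_expr :: "nat \<Rightarrow> dvar dexpr" where
  "Phi_expr n =
     (let r = Var (R, 0);
          s = Mul (Const (- (real n - 1) / 2)) (Dx r)
      in Mul (Inv (dpow r n)) ((Psi_expr r s ^^ n) (Var (Y, 0))))"

definition r_to_u2 :: "dvar dexpr \<Rightarrow> dvar dexpr" where
  "r_to_u2 = dsubst (\<lambda>(f, k).
     if f = R then (Dx ^^ k) (Mul (Var (U, 0)) (Var (U, 0))) else Var (f, k))"

definition minus_u_q :: "dvar dexpr" where
  "minus_u_q = Mul (Const (-1)) (Mul (Var (U, 0)) (Var (Q, 0)))"

text \<open>
  One differentiation followed by \<open>u'' = - q u\<close>. Applied to an expression that contains no
  derivative of \<open>u\<close> of order at least two, it returns an expression of the same kind.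
\<close>

definition Dx_red :: "dvar dexpr \<Rightarrow> dvar dexpr" where
  "Dx_red e = dsubst (\<lambda>v. if v = (U, 2) then minus_u_q else Var v) (Dx e)"

fun u_deriv :: "nat \<Rightarrow> dvar dexpr" where
  "u_deriv 0 = Var (U, 0)"
| "u_deriv (Suc 0) = Var (U, 1)"
| "u_deriv (Suc (Suc j)) = (Dx_red ^^ j) minus_u_q"

definition eliminate_u :: "dvar dexpr \<Rightarrow> dvar dexpr" where
  "eliminate_u = dsubst (\<lambda>(f, k). if f = U then u_deriv k else Var (f, k))"

definition Theta_expr :: "nat \<Rightarrow> dvar dexpr" where
  "Theta_expr n = eliminate_u (r_to_u2 (Phi_expr n))"


section \<open>Linear equations and iterative equations on an interval\<close>

definition open_interval :: "real set \<Rightarrow> bool" where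
  "open_interval J \<longleftrightarrow> open J \<and> is_interval J \<and> J \<noteq> {}"

definition smooth_on :: "real set \<Rightarrow> (real \<Rightarrow> real) \<Rightarrow> bool" where
  "smooth_on J f \<longleftrightarrow> (\<forall>k. \<forall>x\<in>J. (deriv ^^ k) f differentiable (at x))"

type_synonym operator = "(real \<Rightarrow> real) \<Rightarrow> real \<Rightarrow> real"

definition same_equation :: "real set \<Rightarrow> operator \<Rightarrow> operator \<Rightarrow> bool" where
  "same_equation J L M \<longleftrightarrow>
     (\<exists>m. smooth_on J m \<and> (\<forall>x\<in>J. m x \<noteq> 0) \<and>
          (\<forall>y. smooth_on J y \<longrightarrow> (\<forall>x\<in>J. L y x = m x * M y x)))"

definition Psi :: "(real \<Rightarrow> real) \<Rightarrow> (real \<Rightarrow> real) \<Rightarrow> operator" where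
  "Psi r s y = (\<lambda>x. r x * deriv y x + s x * y x)"

definition iterative :: "real set \<Rightarrow> nat \<Rightarrow> operator \<Rightarrow> bool" where
  "iterative J n L \<longleftrightarrow>
     (\<exists>r s. smooth_on J r \<and> smooth_on J s \<and> (\<forall>x\<in>J. r x \<noteq> 0) \<and>
            same_equation J L (Psi r s ^^ n))"

definition normal_form :: "nat \<Rightarrow> (nat \<Rightarrow> real \<Rightarrow> real) \<Rightarrow> operator" where
  "normal_form n A y x = (deriv ^^ n) y x + (\<Sum>j=2..n. A j x * (deriv ^^ (n - j)) y x)"

text \<open>
  The linear operator of order \<open>n\<close> whose coefficient of \<open>y\<^bsup>(n - j)\<^esup>\<close> is the expression \<open>B j\<close>
  in the variables \<open>k\<close>, the \<open>k\<close>-th derivative of \<open>q\<close>.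
\<close>

definition operator_of :: "nat \<Rightarrow> (nat \<Rightarrow> nat dexpr) \<Rightarrow> (real \<Rightarrow> real) \<Rightarrow> operator" where
  "operator_of n B q y x =
     (\<Sum>j\<le>n. dval (\<lambda>k. (deriv ^^ k) q x) (B j) * (deriv ^^ (n - j)) y x)"

end

theory Submission
  imports Defs
begin

text \<open>
  Write \<open>m = n - 1\<close>. The operator \<open>\<Psi>\<close> with \<open>s = - m r' / 2\<close> is \<open>r (D - m a)\<close>, where \<open>a = r' / (2 r)\<close>.
  For \<open>r = u\<^sup>2\<close> this \<open>a\<close> is the logarithmic derivative \<open>u' / u\<close>, so that \<open>u'' = - q u\<close> becomes the
  Riccati equation \<open>a' = - q - a\<^sup>2\<close>; conversely any \<open>r\<close> without zeros determines such a \<open>q\<close>, whatever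
  its sign. The normalized iterates \<open>w\<^sub>j = \<Psi>\<^sup>j y / r\<^sup>j\<close> satisfy \<open>w\<^sub>j\<^sub>+\<^sub>1 = w\<^sub>j' - (m - 2 j) a w\<^sub>j\<close>. On the other
  hand, let
  \<open>M\<^sub>0 = y\<close>, \<open>M\<^sub>1 = y'\<close>, \<open>M\<^sub>k\<^sub>+\<^sub>1 = M\<^sub>k' + k (m - k + 1) q M\<^sub>k\<^sub>-\<^sub>1\<close>,
  the recursion that produces the symmetric powers of \<open>y'' + q y = 0\<close>. Its coefficients are
  polynomials in \<open>q\<close> and its derivatives by construction, with leading coefficients \<open>1, 0\<close>. By the
  Riccati equation, \<open>M\<^sub>k\<close> is a combination of the \<open>a\<^sup>k\<^sup>-\<^sup>j w\<^sub>j\<close> whose coefficient contains the product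
  \<open>(m - j) (m - j - 1) \<cdots> (m - k + 1)\<close> (lemma \<open>symop_eq_sum_normalized_iter\<close>). For \<open>k = n = m + 1\<close> this
  product vanishes unless \<open>j = n\<close>, hence \<open>M\<^sub>n = \<Psi>\<^sup>n y / r\<^sup>n\<close> (lemma \<open>psi_fps_funpow_eq_symop\<close>).

  This identity is proved in the ring of formal power series over the reals. It then serves twice.
  A valuation of the differential variables is the sequence of Taylor coefficients of suitable power
  series, which gives the claim on the expression \<open>\<Theta>\<^sub>n\<^sup>u\<close> (lemma \<open>dval_Theta_expr\<close>); and taking
  Taylor jets at a point is a homomorphism of differential rings on smooth functions, which gives
  the identity of the operators on an interval (lemma \<open>Psi_funpow_eq_operator_of\<close>).

  If an equation in normal form is iterative, applying both operators to \<open>(t - x)\<^sup>n\<^sup>-\<^sup>1\<close> at each point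
  \<open>x\<close> forces \<open>s = - m r' / 2\<close>, and the identity exhibits the equation as \<open>\<Theta>\<^sub>n\<^sup>u[y] = 0\<close> with
  \<open>q = - a' - a\<^sup>2\<close>. If \<open>q\<close> is given, the Riccati equation is solved near the point by Banach's
  fixed point theorem, and \<open>r = exp (2 \<integral> a)\<close>.
\<close>

unbundle no vec_syntax
unbundle fps_syntax

section \<open>Iterates of \<open>\<Psi>\<close> on power series\<close>

definition psi_fps :: "real fps \<Rightarrow> real fps \<Rightarrow> real fps \<Rightarrow> real fps" where
  "psi_fps r s f = r * fps_deriv f + s * f"

text \<open>
  The operators \<open>M\<^sub>k\<close> of the introduction. For natural \<open>m\<close>, \<open>symop m q (m + 1)\<close> is the
  \<open>m\<close>-th symmetric power of \<open>D\<^sup>2 + q\<close>.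
\<close>

fun symop :: "real \<Rightarrow> real fps \<Rightarrow> nat \<Rightarrow> real fps \<Rightarrow> real fps" where
  "symop m q 0 f = f"
| "symop m q (Suc 0) f = fps_deriv f"
| "symop m q (Suc (Suc k)) f =
     fps_deriv (symop m q (Suc k) f) + fps_const ((real k + 1) * (m - real k)) * q * symop m q k f"

text \<open>
  The recursion obeyed by \<open>\<Psi>\<^sup>j f / r\<^sup>j\<close>. Setting it up directly avoids division by \<open>r\<close>.
\<close>

primrec normalized_iter :: "real \<Rightarrow> real fps \<Rightarrow> real fps \<Rightarrow> nat \<Rightarrow> real fps" where
  "normalized_iter m a f 0 = f"
| "normalized_iter m a f (Suc j) = fps_deriv (normalized_iter m a f j) - fps_const (m - 2 * real j) * a * normalized_iter m a f j"

text \<open>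
  Differentiating \<open>r\<^sup>j\<close> contributes \<open>2 j a\<close>, which turns the weight \<open>m\<close> into \<open>m - 2 j\<close>.
\<close>

lemma psi_fps_funpow_eq_normalized_iter:
  assumes a: "fps_deriv r = fps_const 2 * a * r"
  shows "(psi_fps r (fps_const (- m / 2) * fps_deriv r) ^^ j) f = r ^ j * normalized_iter m a f j"
proof (induction j)
  case (Suc j)
  have D: "r * fps_deriv (r ^ j) = of_nat j * r ^ j * (fps_const 2 * a * r)"
    unfolding fps_deriv_power' a by (cases j) (simp_all add: algebra_simps)
  have c: "fps_const (m - 2 * real j) = fps_const m - fps_const 2 * of_nat j"
          "fps_const (- m / 2) * fps_const 2 = - fps_const m"
    by (simp_all add: fps_of_nat [symmetric])
  have "psi_fps r (fps_const (- m / 2) * fps_deriv r) (r ^ j * normalized_iter m a f j) = 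
     (r * fps_deriv (r ^ j)) * normalized_iter m a f j + r ^ Suc j * fps_deriv (normalized_iter m a f j)
      + (fps_const (- m / 2) * fps_const 2) * a * r * r ^ j * normalized_iter m a f j"
    by (simp add: psi_fps_def a algebra_simps)
  also have "\<dots> = r ^ Suc j * normalized_iter m a f (Suc j)"
    unfolding D c normalized_iter.simps by (simp add: algebra_simps del: fps_const_neg)
  finally show ?case using Suc by simp
qed simp

text \<open>
  The coefficient of \<open>a\<^sup>k\<^sup>-\<^sup>j w\<^sub>j\<close> in \<open>M\<^sub>k\<close>. The model case is \<open>f = u\<^sup>m\<close> with \<open>u' = a u\<close>, where \<open>w\<^sub>j = 0\<close> for
  \<open>j > 0\<close> and \<open>M\<^sub>k f = m (m - 1) \<cdots> (m - k + 1) a\<^sup>k f\<close>.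
\<close>

definition riccati_coeff :: "real \<Rightarrow> nat \<Rightarrow> nat \<Rightarrow> real" where
  "riccati_coeff m k j = real (k choose j) * (\<Prod>i=j..<k. m - real i)"

lemma riccati_coeff_Suc_0: "riccati_coeff m (Suc k) 0 = riccati_coeff m k 0 * (m - real k)"
  by (simp add: riccati_coeff_def)

text \<open>
  Comparison of the terms \<open>a\<^sup>k\<^sup>-\<^sup>j w\<^sub>j\<^sub>+\<^sub>1\<close> in the derivative of the expansion of \<open>M\<^sub>k\<close>: the factor
  \<open>m - k - (j + 1)\<close> collects the part \<open>- a\<^sup>2\<close> of \<open>a'\<close> and the weight of \<open>w\<^sub>j\<^sub>+\<^sub>1\<close>. It reduces to the
  absorption identity for binomial coefficients.
\<close>

lemma riccati_coeff_Suc_Suc: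
  "riccati_coeff m (Suc k) (Suc j) = riccati_coeff m k (Suc j) * (m - real k - real (Suc j)) + riccati_coeff m k j"
proof (cases "j < k")
  case True
  define p where "p = (\<Prod>i=Suc j..<k. m - real i)"
  have p: "(\<Prod>i=Suc j..<Suc k. m - real i) = p * (m - real k)"
    "(\<Prod>i=j..<k. m - real i) = (m - real j) * p"
    using True by (simp_all add: p_def prod.atLeast_Suc_lessThan)
  have b: "real (Suc j) * real (k choose Suc j) = (real k - real j) * real (k choose j)"
  proof -
    have "Suc j * (k choose Suc j) = (k - j) * (k choose j)"
      by (simp only: binomial_absorption binomial_absorb_comp)
    then have "real (Suc j) * real (k choose Suc j) = real (k - j) * real (k choose j)"
      by (metis of_nat_mult)
    then show ?thesis using True by (simp only: of_nat_diff less_imp_le)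
  qed
  have "riccati_coeff m k (Suc j) * (m - real k - real (Suc j)) + riccati_coeff m k j
      = p * ((m - real k) * real (k choose Suc j) - real (Suc j) * real (k choose Suc j)
             + (m - real j) * real (k choose j))"
    unfolding riccati_coeff_def p p_def[symmetric] by (simp add: algebra_simps)
  also have "\<dots> = p * (m - real k) * (real (k choose Suc j) + real (k choose j))"
    unfolding b by (simp add: algebra_simps)
  also have "\<dots> = riccati_coeff m (Suc k) (Suc j)"
    unfolding riccati_coeff_def p by (simp add: algebra_simps)
  finally show ?thesis ..
next
  case False
  then show ?thesis by (cases "j = k") (simp_all add: riccati_coeff_def)
qed

text \<open>
  Comparison of the terms that arise from the part \<open>- q\<close> of \<open>a'\<close>; they are what the summand
  \<open>k (m - k + 1) q M\<^sub>k\<^sub>-\<^sub>1\<close> of the recursion cancels.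
\<close>

lemma riccati_coeff_lower:
  assumes "j \<le> k"
  shows "riccati_coeff m (Suc k) j * (real (Suc k) - real j) = (real k + 1) * (m - real k) * riccati_coeff m k j"
proof -
  have "Suc k - j > 0" using assms by simp
  have "(Suc k - j) * (Suc k choose j) = Suc k * (k choose j)"
    using binomial_absorb_comp[of "Suc k" j] by simp
  hence "real (Suc k - j) * real (Suc k choose j) = real (Suc k) * real (k choose j)"
    by (metis of_nat_mult)
  hence b: "real (Suc k choose j) * (real (Suc k) - real j) = (real k + 1) * real (k choose j)"
    using assms by (simp add: of_nat_diff mult.commute)
  have p: "(\<Prod>i=j..<Suc k. m - real i) = (\<Prod>i=j..<k. m - real i) * (m - real k)"
    using assms by simp
  have "riccati_coeff m (Suc k) j * (real (Suc k) - real j)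
      = (real (Suc k choose j) * (real (Suc k) - real j)) * (\<Prod>i=j..<k. m - real i) * (m - real k)"
    unfolding riccati_coeff_def p by (simp only: ac_simps)
  also have "\<dots> = (real k + 1) * (m - real k) * riccati_coeff m k j"
    unfolding b riccati_coeff_def by (simp only: ac_simps)
  finally show ?thesis .
qed

text \<open>
  Differentiating the right-hand side, \<open>a' = - q - a\<^sup>2\<close> produces the next expansion and, through the
  part \<open>- q\<close>, a multiple of the previous one; this is the recursion that defines \<open>symop\<close>.
\<close>

lemma symop_eq_sum_normalized_iter:
  assumes a: "fps_deriv a = - q - a\<^sup>2"
  shows "symop m q k f = (\<Sum>j\<le>k. fps_const (riccati_coeff m k j) * a ^ (k - j) * normalized_iter m a f j)"
    (is "_ = ?S k")
proof -
  define t where "t k j = fps_const (riccati_coeff m k j) * a ^ (k - j) * normalized_iter m a f j" for k j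
  have Dpow: "fps_deriv (a ^ i) = - of_nat i * a ^ (i - 1) * q - of_nat i * a ^ Suc i" for i
    unfolding fps_deriv_power' a by (cases i) (simp_all add: power2_eq_square algebra_simps)
  \<comment> \<open>The sum over \<open>j\<close> of \<open>q * lo k j\<close> is the contribution of the part \<open>- q\<close> of \<open>a'\<close>, up to sign.\<close>
  define lo where "lo k j = fps_const (riccati_coeff m k j * (real k - real j)) * a ^ (k - j - 1) * normalized_iter m a f j" for k j
  have Dt: "fps_deriv (t k j) = 
       fps_const (riccati_coeff m k j * (m - real k - real j)) * a ^ (Suc k - j) * normalized_iter m a f j
      + fps_const (riccati_coeff m k j) * a ^ (k - j) * normalized_iter m a f (Suc j) - q * lo k j"
    if "j \<le> k" for k j
  proof -
    have e: "a ^ (Suc k - j) = a * a ^ (k - j)" using that by (simp add: Suc_diff_le)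
    have c: "fps_const (riccati_coeff m k j * (m - real k - real j)) = 
        fps_const (riccati_coeff m k j) * (fps_const (m - 2 * real j) - of_nat (k - j))"
      "fps_const (riccati_coeff m k j * (real k - real j)) = fps_const (riccati_coeff m k j) * of_nat (k - j)"
      using that by (simp_all add: fps_of_nat [symmetric] of_nat_diff)
    show ?thesis
      unfolding t_def lo_def c e fps_deriv_mult Dpow
      by (simp add: algebra_simps)
  qed
  have DS: "fps_deriv (?S k) = ?S (Suc k) - q * (\<Sum>j\<le>k. lo k j)" for k
  proof -
    have "?S (Suc k) = fps_const (riccati_coeff m (Suc k) 0) * a ^ (Suc k) * normalized_iter m a f 0 +
       (\<Sum>j\<le>k. fps_const (riccati_coeff m (Suc k) (Suc j)) * a ^ (k - j) * normalized_iter m a f (Suc j))"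
      by (subst sum.atMost_Suc_shift) simp
    also have "\<dots> = fps_const (riccati_coeff m k 0 * (m - real k)) * a ^ (Suc k) * normalized_iter m a f 0 +
       (\<Sum>j\<le>k. fps_const (riccati_coeff m k (Suc j) * (m - real k - real (Suc j))) * a ^ (k - j) * normalized_iter m a f (Suc j))
       + (\<Sum>j\<le>k. fps_const (riccati_coeff m k j) * a ^ (k - j) * normalized_iter m a f (Suc j))"
      unfolding riccati_coeff_Suc_Suc riccati_coeff_Suc_0
      by (simp only: sum.distrib[symmetric] add.assoc fps_const_add[symmetric] distrib_right)
    also have "fps_const (riccati_coeff m k 0 * (m - real k)) * a ^ (Suc k) * normalized_iter m a f 0 +
       (\<Sum>j\<le>k. fps_const (riccati_coeff m k (Suc j) * (m - real k - real (Suc j))) * a ^ (k - j) * normalized_iter m a f (Suc j))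
       = (\<Sum>j\<le>Suc k. fps_const (riccati_coeff m k j * (m - real k - real j)) * a ^ (Suc k - j) * normalized_iter m a f j)"
      by (subst sum.atMost_Suc_shift) simp
    also have "\<dots> = (\<Sum>j\<le>k. fps_const (riccati_coeff m k j * (m - real k - real j)) * a ^ (Suc k - j) * normalized_iter m a f j)"
      by (simp add: riccati_coeff_def)
    finally have *: "?S (Suc k) = \<dots> + (\<Sum>j\<le>k. fps_const (riccati_coeff m k j) * a ^ (k - j) * normalized_iter m a f (Suc j))" .
    have "fps_deriv (?S k) = (\<Sum>j\<le>k. fps_deriv (t k j))"
      unfolding t_def by (simp only: fps_deriv_sum)
    also have "\<dots> = (\<Sum>j\<le>k. fps_const (riccati_coeff m k j * (m - real k - real j)) * a ^ (Suc k - j) * normalized_iter m a f j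
      + fps_const (riccati_coeff m k j) * a ^ (k - j) * normalized_iter m a f (Suc j) - q * lo k j)"
      by (intro sum.cong refl Dt) simp
    also have "\<dots> = ?S (Suc k) - q * (\<Sum>j\<le>k. lo k j)"
      unfolding * by (simp only: sum.distrib sum_subtractf sum_distrib_left)
    finally show ?thesis .
  qed
  have lo: "(\<Sum>j\<le>Suc k. lo (Suc k) j) = fps_const ((real k + 1) * (m - real k)) * ?S k" for k
  proof -
    have "(\<Sum>j\<le>Suc k. lo (Suc k) j) = (\<Sum>j\<le>k. lo (Suc k) j)" by (simp add: lo_def)
    also have "\<dots> = (\<Sum>j\<le>k. fps_const ((real k + 1) * (m - real k)) * t k j)"
      by (intro sum.cong refl) (simp add: lo_def t_def riccati_coeff_lower mult.assoc[symmetric] del: of_nat_Suc)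
    finally show ?thesis by (simp add: t_def sum_distrib_left)
  qed
  have lo0: "lo 0 0 = 0"
    by (simp add: lo_def)
  have "symop m q k f = ?S k \<and> symop m q (Suc k) f = ?S (Suc k)" for k
  proof (induction k)
    case 0
    have s00: "riccati_coeff m 0 0 = 1"
      by (simp add: riccati_coeff_def)
    then show ?case
      using DS[of 0] lo0 by simp
  next
    case (Suc k)
    have "symop m q (Suc (Suc k)) f
        = fps_deriv (?S (Suc k)) + fps_const ((real k + 1) * (m - real k)) * q * ?S k"
      using Suc by (simp del: sum.atMost_Suc)
    also have "\<dots> = ?S (Suc (Suc k))"
      unfolding DS lo by (simp only: algebra_simps)
    finally show ?case
      using Suc by blast
  qed
  then show ?thesis by blast
qed

text \<open>
  For \<open>k = n\<close> and \<open>j < n\<close> the product in \<open>riccati_coeff\<close> contains the factor \<open>(n - 1) - (n - 1)\<close>, so only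
  \<open>w\<^sub>n\<close> survives and \<open>a\<close> disappears from the result.
\<close>

lemma symop_eq_normalized_iter:
  assumes "fps_deriv a = - q - a\<^sup>2"
  shows "symop (real n - 1) q n f = normalized_iter (real n - 1) a f n"
proof -
  have "riccati_coeff (real n - 1) n j = 0" if "j < n" for j
    using that by (auto simp: riccati_coeff_def intro!: bexI[of _ "n - 1"])
  hence "(\<Sum>j\<le>n. fps_const (riccati_coeff (real n - 1) n j) * a ^ (n - j) * normalized_iter (real n - 1) a f j)
      = (\<Sum>j\<in>{n}. fps_const (riccati_coeff (real n - 1) n j) * a ^ (n - j) * normalized_iter (real n - 1) a f j)"
    by (intro sum.mono_neutral_right) auto
  thus ?thesis
    by (simp add: symop_eq_sum_normalized_iter[OF assms] riccati_coeff_def)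
qed

lemma psi_fps_funpow_eq_symop:
  assumes "fps_deriv r = fps_const 2 * a * r" and "fps_deriv a = - q - a\<^sup>2"
  shows "(psi_fps r (fps_const (- (real n - 1) / 2) * fps_deriv r) ^^ n) f
           = r ^ n * symop (real n - 1) q n f"
  by (simp only: psi_fps_funpow_eq_normalized_iter[OF assms(1)] symop_eq_normalized_iter[OF assms(2)])

section \<open>Coefficients as differential expressions in \<open>q\<close>\<close>

lemma fps_deriv_sum_coeffs:
  fixes f :: "real fps"
  assumes "C (Suc k) = 0"
  shows "fps_deriv (\<Sum>i\<le>k. C i * (fps_deriv ^^ i) f)
       = (\<Sum>i\<le>Suc k. (fps_deriv (C i) + (if i = 0 then 0 else C (i - 1))) * (fps_deriv ^^ i) f)"
proof -
  have "(\<Sum>i\<le>Suc k. (if i = 0 then 0 else C (i - 1)) * (fps_deriv ^^ i) f)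
      = (\<Sum>i\<le>k. C i * (fps_deriv ^^ Suc i) f)"
    by (subst sum.atMost_Suc_shift) simp
  then show ?thesis
    by (simp add: fps_deriv_sum distrib_right sum.distrib assms)
qed

text \<open>
  The expression of the coefficient of \<open>f\<^bsup>(i)\<^esup>\<close> in \<open>symop m q k f\<close>, obtained by reading the recursion
  of \<open>symop\<close> coefficientwise. It contains the variables of \<open>q\<close> only.
\<close>

fun symop_coeff :: "real \<Rightarrow> nat \<Rightarrow> nat \<Rightarrow> dvar dexpr" where
  "symop_coeff m 0 i = Const (if i = 0 then 1 else 0)"
| "symop_coeff m (Suc 0) i = Const (if i = 1 then 1 else 0)"
| "symop_coeff m (Suc (Suc k)) i =
     Add (Add (Dx (symop_coeff m (Suc k) i)) (if i = 0 then Const 0 else symop_coeff m (Suc k) (i - 1)))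
         (Mul (Mul (Const ((real k + 1) * (m - real k))) (Var (Q, 0))) (symop_coeff m k i))"

text \<open>
  Evaluation with the unknown functions replaced by power series. Its constant coefficient is the
  ordinary value, and \<open>Dx\<close> becomes the derivation of the power series ring, so that formal identities
  between differential expressions reduce to identities between power series.
\<close>

primrec fps_val :: "(unknown \<Rightarrow> real fps) \<Rightarrow> dvar dexpr \<Rightarrow> real fps" where
  "fps_val F (Const c) = fps_const c"
| "fps_val F (Var v) = (fps_deriv ^^ snd v) (F (fst v))"
| "fps_val F (Add a b) = fps_val F a + fps_val F b"
| "fps_val F (Mul a b) = fps_val F a * fps_val F b"
| "fps_val F (Inv a) = inverse (fps_val F a)"

lemma fps_val_nth_0: "fps_val F e $ 0 = dval (\<lambda>v. (fps_deriv ^^ snd v) (F (fst v)) $ 0) e"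
  by (induction e) simp_all

lemma fps_val_Dx: "fps_val F (Dx e) = fps_deriv (fps_val F e)"
proof (induction e)
  case (Inv a)
  show ?case
  proof (cases "fps_val F a $ 0 = 0")
    case False
    then show ?thesis
      using Inv by (simp add: fps_inverse_deriv fps_inverse_mult power2_eq_square del: fps_const_neg flip: fps_const_neg)
  next
    case True
    \<comment> \<open>The inverse of a series without constant term is \<open>0\<close>, in agreement with \<open>inverse 0 = 0\<close> for reals.\<close>
    hence "inverse (fps_val F a) = 0" "inverse (fps_val F a * fps_val F a) = 0"
      by (simp_all only: fps_inverse_eq_0_iff fps_mult_nth_0 mult_zero_left)
    then show ?thesis
      unfolding Dx.simps fps_val.simps by (simp only: mult_zero_right) simp
  qed
qed (simp_all add: algebra_simps)

lemma fps_val_Dx_funpow: "fps_val F ((Dx ^^ k) e) = (fps_deriv ^^ k) (fps_val F e)"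
  by (induction k) (simp_all add: fps_val_Dx)

lemma fps_val_dpow: "fps_val F (dpow e k) = fps_val F e ^ k"
  by (induction k) simp_all

lemma fps_val_dsubst:
  assumes "\<And>v. fps_val F (\<sigma> v) = fps_val G (Var v)"
  shows "fps_val F (dsubst \<sigma> e) = fps_val G e"
  using assms by (induction e) simp_all

lemma fps_val_Phi_expr:
  "fps_val F (Phi_expr n) = inverse (F R ^ n) *
     (psi_fps (F R) (fps_const (- (real n - 1) / 2) * fps_deriv (F R)) ^^ n) (F Y)"
proof -
  have psi: "fps_val F ((Psi_expr a b ^^ k) e) = (psi_fps (fps_val F a) (fps_val F b) ^^ k) (fps_val F e)" for a b e k
    by (induction k) (simp_all add: Psi_expr_def psi_fps_def fps_val_Dx)
  show ?thesis
    by (simp add: Phi_expr_def Let_def psi fps_val_dpow)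
qed

lemma fps_val_r_to_u2: "fps_val F (r_to_u2 e) = fps_val (F(R := F U * F U)) e"
  unfolding r_to_u2_def by (rule fps_val_dsubst) (auto simp: fps_val_Dx_funpow simp del: fps_deriv_mult split: if_splits)

text \<open>
  Substituting \<open>- u q\<close> for \<open>u''\<close> does not change the value once the series satisfy the differential
  equation, so \<open>Dx_red\<close> acts as the derivation too.
\<close>

lemma fps_val_u_deriv:
  assumes "fps_deriv (fps_deriv (F U)) = - (F U * F Q)"
  shows "fps_val F (u_deriv k) = (fps_deriv ^^ k) (F U)"
proof -
  have muq: "fps_val F minus_u_q = fps_deriv (fps_deriv (F U))"
    using assms by (simp add: minus_u_q_def del: fps_const_neg flip: fps_const_neg)
  have red: "fps_val F (Dx_red e) = fps_deriv (fps_val F e)" for e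
    unfolding Dx_red_def fps_val_Dx[symmetric] using muq
    by (intro fps_val_dsubst) (auto simp: numeral_2_eq_2)
  have "fps_val F ((Dx_red ^^ j) minus_u_q) = (fps_deriv ^^ Suc (Suc j)) (F U)" for j
    by (induction j) (simp_all add: red muq)
  then show ?thesis
    by (cases k rule: u_deriv.cases) simp_all
qed

lemma fps_val_eliminate_u:
  assumes "fps_deriv (fps_deriv (F U)) = - (F U * F Q)"
  shows "fps_val F (eliminate_u e) = fps_val F e"
  unfolding eliminate_u_def
  by (rule fps_val_dsubst) (auto simp: fps_val_u_deriv[OF assms])

lemma fps_val_Theta_expr:
  assumes "fps_deriv (fps_deriv (F U)) = - (F U * F Q)" and nz: "F U $ 0 \<noteq> 0"
  shows "fps_val F (Theta_expr n) = symop (real n - 1) (F Q) n (F Y)"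
proof -
  define u where "u = F U"
  define a where "a = inverse u * fps_deriv u"
  have iu: "inverse u * u = 1"
    using nz by (simp add: u_def inverse_mult_eq_1)
  have r: "fps_deriv (u * u) = fps_const 2 * a * (u * u)"
  proof -
    have "fps_const 2 * a * (u * u) = fps_const 2 * (inverse u * u) * fps_deriv u * u"
      by (simp add: a_def)
    also have "\<dots> = (fps_deriv u * u) * 2"
      unfolding iu by (simp add: numeral_fps_const)
    also have "\<dots> = fps_deriv (u * u)"
      unfolding fps_deriv_mult by (simp add: algebra_simps)
    finally show ?thesis ..
  qed
  have a: "fps_deriv a = - F Q - a\<^sup>2"
  proof -
    have "fps_deriv a = inverse u * fps_deriv (fps_deriv u) - a\<^sup>2"
      unfolding a_def fps_deriv_mult using nz
      by (simp add: fps_inverse_deriv u_def power2_eq_square)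
    also have "inverse u * fps_deriv (fps_deriv u) = - (inverse u * u) * F Q"
      using assms(1) by (simp add: u_def)
    finally show ?thesis unfolding iu by simp
  qed
  have "fps_val F (Theta_expr n) = inverse ((u * u) ^ n) *
     (psi_fps (u * u) (fps_const (- (real n - 1) / 2) * fps_deriv (u * u)) ^^ n) (F Y)"
    unfolding Theta_expr_def fps_val_eliminate_u[OF assms(1)] fps_val_r_to_u2 fps_val_Phi_expr
    by (simp add: u_def)
  also have "\<dots> = inverse ((u * u) ^ n) * (u * u) ^ n * symop (real n - 1) (F Q) n (F Y)"
    unfolding psi_fps_funpow_eq_symop[OF r a] by simp
  also have "inverse ((u * u) ^ n) * (u * u) ^ n = 1"
    using nz by (intro inverse_mult_eq_1) (simp add: u_def fps_power_zeroth)
  finally show ?thesis by simp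
qed

text \<open>
  The Taylor coefficients of the solution of \<open>u'' = - u q\<close> with initial values \<open>a\<close> and \<open>b\<close>.
\<close>

fun ode_coeff :: "(nat \<Rightarrow> real) \<Rightarrow> real \<Rightarrow> real \<Rightarrow> nat \<Rightarrow> real" where
  "ode_coeff q a b 0 = a"
| "ode_coeff q a b (Suc 0) = b"
| "ode_coeff q a b (Suc (Suc k)) = - (\<Sum>i\<le>k. ode_coeff q a b i * q (k - i)) / (real (Suc k) * real (Suc (Suc k)))"

lemma ex_fps_ode:
  fixes q :: "real fps"
  shows "\<exists>u. u $ 0 = a \<and> u $ 1 = b \<and> fps_deriv (fps_deriv u) = - (u * q)"
proof (intro exI conjI)
  let ?u = "Abs_fps (ode_coeff (fps_nth q) a b)"
  show "?u $ 0 = a" "?u $ 1 = b" by simp_all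
  show "fps_deriv (fps_deriv ?u) = - (?u * q)"
  proof (rule fps_ext)
    fix k
    have "fps_deriv (fps_deriv ?u) $ k
        = real (Suc k) * real (Suc (Suc k)) * ode_coeff (fps_nth q) a b (Suc (Suc k))"
      by (simp del: ode_coeff.simps)
    also have "\<dots> = - (\<Sum>i\<le>k. ode_coeff (fps_nth q) a b i * q $ (k - i))"
      by (simp del: of_nat_Suc)
    finally show "fps_deriv (fps_deriv ?u) $ k = (- (?u * q)) $ k"
      by (simp add: fps_mult_nth atLeast0AtMost)
  qed
qed

lemma dval_cong: "(\<And>v. v \<in> set_dexpr e \<Longrightarrow> \<rho> v = \<rho>' v) \<Longrightarrow> dval \<rho> e = dval \<rho>' e"
  by (induction e) auto

lemma set_dexpr_dsubst: "set_dexpr (dsubst \<sigma> e) = (\<Union>v\<in>set_dexpr e. set_dexpr (\<sigma> v))"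
  by (induction e) auto

lemma set_dexpr_Dx: "set_dexpr (Dx e) \<subseteq> set_dexpr e \<union> (\<lambda>v. (fst v, Suc (snd v))) ` set_dexpr e"
  by (induction e) auto

text \<open>
  A valuation may give the derivatives of \<open>u\<close> of order at least two values that contradict the
  differential equation. Since these variables have been eliminated, the values can be replaced.
\<close>

lemma set_dexpr_eliminate_u: "set_dexpr (eliminate_u e) \<subseteq> {v. fst v = U \<longrightarrow> snd v < 2}"
proof -
  let ?W = "{v :: dvar. fst v = U \<longrightarrow> snd v < 2}"
  have muq: "set_dexpr minus_u_q \<subseteq> ?W" by (auto simp: minus_u_q_def)
  have red: "set_dexpr (Dx_red e) \<subseteq> ?W" if "set_dexpr e \<subseteq> ?W" for e
  proof
    fix w assume "w \<in> set_dexpr (Dx_red e)"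
    then obtain v where v: "v \<in> set_dexpr (Dx e)"
      "w \<in> set_dexpr (if v = (U, 2) then minus_u_q else Var v)"
      unfolding Dx_red_def set_dexpr_dsubst by blast
    show "w \<in> ?W"
    proof (cases "v = (U, 2)")
      case True
      then show ?thesis using v muq by auto
    next
      case False
      then have "w = v" using v(2) by simp
      moreover have "v \<in> ?W" using v(1) False set_dexpr_Dx[of e] that by (force simp: prod_eq_iff)
      ultimately show ?thesis by simp
    qed
  qed
  have "set_dexpr ((Dx_red ^^ j) minus_u_q) \<subseteq> ?W" for j
    by (induction j) (simp_all add: red muq)
  then have "set_dexpr (u_deriv k) \<subseteq> ?W" for k
    by (cases k rule: u_deriv.cases) simp_all
  then show ?thesis
    unfolding eliminate_u_def set_dexpr_dsubst
    by (intro UN_least) (auto split: if_splits simp: subset_iff)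
qed

text \<open>
  Only the unknown \<open>q\<close> occurs in \<open>symop_coeff\<close>, so forgetting the names of the unknowns loses nothing.
\<close>

definition Theta_coeff :: "nat \<Rightarrow> nat \<Rightarrow> nat dexpr" where
  "Theta_coeff n j = dsubst (\<lambda>v. Var (snd v)) (symop_coeff (real n - 1) n (n - j))"

lemma dval_Theta_coeff:
  "dval (\<lambda>k. (fps_deriv ^^ k) q $ 0) (Theta_coeff n j) = fps_val (\<lambda>_. q) (symop_coeff (real n - 1) n (n - j)) $ 0"
proof -
  have "dval \<tau> (dsubst (\<lambda>v. Var (snd v)) e) = dval (\<lambda>v. \<tau> (snd v)) e" for \<tau> and e :: "dvar dexpr"
    by (induction e) simp_all
  then show ?thesis by (simp add: Theta_coeff_def fps_val_nth_0)
qed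

lemma fps_val_symop_coeff:
  fixes q :: "real fps"
  defines "C \<equiv> \<lambda>m k i. fps_val (\<lambda>_. q) (symop_coeff m k i)"
  shows symop_coeff_gt: "k < i \<Longrightarrow> C m k i = 0"
    and symop_coeff_same: "C m k k = 1"
    and symop_coeff_pred: "C m (Suc k) k = 0"
    and symop_eq_sum_symop_coeff: "symop m q k f = (\<Sum>i\<le>k. C m k i * (fps_deriv ^^ i) f)"
proof -
  have rec: "C m (Suc (Suc k)) i = fps_deriv (C m (Suc k) i) + (if i = 0 then 0 else C m (Suc k) (i - 1))
      + fps_const ((real k + 1) * (m - real k)) * q * C m k i" for k i
    by (simp add: C_def fps_val_Dx)
  have base: "C m 0 i = (if i = 0 then 1 else 0)" "C m (Suc 0) i = (if i = 1 then 1 else 0)" for i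
    by (simp_all add: C_def)
  have gt: "k < i \<longrightarrow> C m k i = 0" for k i
  proof (induction k arbitrary: i rule: induct_nat_012)
    case (ge2 k)
    then show ?case by (auto simp: rec)
  qed (simp_all add: base)
  then show "k < i \<Longrightarrow> C m k i = 0" by blast
  have same: "C m k k = 1" for k
    by (induction k rule: induct_nat_012) (simp_all add: base rec gt)
  then show "C m k k = 1" .
  show "C m (Suc k) k = 0"
  proof (induction k)
    case (Suc k)
    then show ?case by (cases k) (simp_all add: rec gt same base)
  qed (simp_all add: base)
  show "symop m q k f = (\<Sum>i\<le>k. C m k i * (fps_deriv ^^ i) f)"
  proof (induction k rule: induct_nat_012)
    case (ge2 k)
    have "(\<Sum>i\<le>k. C m k i * (fps_deriv ^^ i) f) = (\<Sum>i\<le>Suc (Suc k). C m k i * (fps_deriv ^^ i) f)"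
      by (simp add: gt)
    then show ?case
      unfolding symop.simps ge2 by (subst fps_deriv_sum_coeffs)
        (simp_all only: gt lessI rec sum_distrib_left sum.distrib[symmetric] distrib_right mult.assoc)
  qed (simp_all add: base)
qed

lemma symop_nth_0:
  "symop (real n - 1) q n f $ 0
     = (\<Sum>j\<le>n. dval (\<lambda>k. (fps_deriv ^^ k) q $ 0) (Theta_coeff n j) * (fps_deriv ^^ (n - j)) f $ 0)"
proof -
  have "symop (real n - 1) q n f $ 0
     = (\<Sum>i\<le>n. fps_val (\<lambda>_. q) (symop_coeff (real n - 1) n i) $ 0 * (fps_deriv ^^ i) f $ 0)"
    by (simp add: symop_eq_sum_symop_coeff fps_sum_nth)
  also have "\<dots> = (\<Sum>j\<le>n. fps_val (\<lambda>_. q) (symop_coeff (real n - 1) n (n - j)) $ 0 * (fps_deriv ^^ (n - j)) f $ 0)"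
    by (rule sum.reindex_bij_witness[of _ "\<lambda>j. n - j" "\<lambda>j. n - j"]) auto
  finally show ?thesis by (simp add: dval_Theta_coeff)
qed

lemma nth_0_fps_deriv_Abs_fps:
  "(fps_deriv ^^ k) (Abs_fps (\<lambda>k. \<tau> k / fact k)) $ 0 = (\<tau> k :: real)"
  by (simp add: fps_0th_higher_deriv)

lemma dval_Theta_coeff_0: "dval \<tau> (Theta_coeff n 0) = 1"
  using dval_Theta_coeff[of "Abs_fps (\<lambda>k. \<tau> k / fact k)" n 0]
  by (simp add: nth_0_fps_deriv_Abs_fps symop_coeff_same)

lemma dval_Theta_coeff_1: "n \<ge> 1 \<Longrightarrow> dval \<tau> (Theta_coeff n 1) = 0"
  using dval_Theta_coeff[of "Abs_fps (\<lambda>k. \<tau> k / fact k)" n 1]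
  by (cases n) (simp_all add: nth_0_fps_deriv_Abs_fps symop_coeff_pred)

text \<open>
  The values of \<open>q\<close> and \<open>y\<close> under the valuation are the derivatives at \<open>0\<close> of power series, and \<open>u\<close> is
  replaced by the series solution of \<open>u'' = - q u\<close> that has the prescribed \<open>u (0)\<close> and \<open>u' (0)\<close>.
\<close>

lemma dval_Theta_expr:
  assumes nz: "\<rho> (U, 0) \<noteq> 0"
  shows "dval \<rho> (Theta_expr n) = (\<Sum>j\<le>n. dval (\<lambda>k. \<rho> (Q, k)) (Theta_coeff n j) * \<rho> (Y, n - j))"
proof -
  define jet where "jet f = Abs_fps (\<lambda>k. \<rho> (f, k) / fact k)" for f
  have jet: "(fps_deriv ^^ k) (jet f) $ 0 = \<rho> (f, k)" for f k
    unfolding jet_def by (rule nth_0_fps_deriv_Abs_fps)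
  obtain u where u: "u $ 0 = \<rho> (U, 0)" "u $ 1 = \<rho> (U, 1)" "fps_deriv (fps_deriv u) = - (u * jet Q)"
    using ex_fps_ode by blast
  define F where "F = jet(U := u)"
  have "dval \<rho> (Theta_expr n) = dval (\<lambda>v. (fps_deriv ^^ snd v) (F (fst v)) $ 0) (Theta_expr n)"
  proof (rule dval_cong)
    fix v assume "v \<in> set_dexpr (Theta_expr n)"
    then have "fst v = U \<longrightarrow> snd v < 2"
      using set_dexpr_eliminate_u by (auto simp: Theta_expr_def)
    then have "fst v = U \<longrightarrow> v = (U, 0) \<or> v = (U, 1)"
      by (cases v) auto
    then show "\<rho> v = (fps_deriv ^^ snd v) (F (fst v)) $ 0"
      using u by (cases v) (auto simp: F_def jet)
  qed
  also have "\<dots> = symop (real n - 1) (F Q) n (F Y) $ 0"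
    using u nz by (subst fps_val_nth_0[symmetric], subst fps_val_Theta_expr) (simp_all add: F_def)
  finally show ?thesis
    by (simp add: symop_nth_0 F_def jet)
qed

section \<open>Smooth functions and their Taylor jets\<close>

text \<open>
  Truncating smoothness at a finite order allows solutions of differential equations to gain one order
  at a time.
\<close>

definition diff_upto :: "nat \<Rightarrow> real set \<Rightarrow> (real \<Rightarrow> real) \<Rightarrow> bool" where
  "diff_upto k J f \<longleftrightarrow> (\<forall>i\<le>k. \<forall>x\<in>J. (deriv ^^ i) f differentiable (at x))"

lemma smooth_on_iff: "smooth_on J f \<longleftrightarrow> (\<forall>k. diff_upto k J f)"
  unfolding smooth_on_def diff_upto_def by blast

lemma diff_upto_0: "diff_upto 0 J f \<longleftrightarrow> (\<forall>x\<in>J. f differentiable (at x))"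
  by (simp add: diff_upto_def)

lemma diff_upto_Suc:
  "diff_upto (Suc k) J f \<longleftrightarrow> (\<forall>x\<in>J. f differentiable (at x)) \<and> diff_upto k J (deriv f)"
proof -
  have split: "(\<forall>i\<le>Suc k. p i) \<longleftrightarrow> p 0 \<and> (\<forall>i\<le>k. p (Suc i))" for p
  proof safe
    fix i assume "p 0" "\<forall>i\<le>k. p (Suc i)" "i \<le> Suc k"
    then show "p i" by (cases i) auto
  qed auto
  show ?thesis
    unfolding diff_upto_def split by (simp only: funpow_0 funpow_Suc_right comp_def)
qed

lemma diff_upto_SucD: "diff_upto (Suc k) J f \<Longrightarrow> diff_upto k J f"
  unfolding diff_upto_def by (blast intro: le_SucI)

lemma diff_upto_has_deriv:
  assumes "diff_upto k J f" "x \<in> J"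
  shows "(f has_real_derivative deriv f x) (at x)"
proof -
  have "(deriv ^^ 0) f differentiable (at x)"
    using assms unfolding diff_upto_def by blast
  then show ?thesis by (simp add: DERIV_deriv_iff_real_differentiable)
qed

lemma deriv_cong_open:
  assumes "open J" "\<And>x. x \<in> J \<Longrightarrow> f x = g x" "x \<in> J"
  shows "deriv f x = deriv g x"
  using assms by (intro deriv_cong_ev) (auto simp: eventually_nhds)

lemma differentiable_cong_open:
  fixes f g :: "real \<Rightarrow> real"
  assumes J: "open J" and eq: "\<And>x. x \<in> J \<Longrightarrow> f x = g x" and x: "x \<in> J" and f: "f differentiable (at x)"
  shows "g differentiable (at x)"
proof -
  obtain D where "(f has_real_derivative D) (at x)"
    using f unfolding real_differentiable_def by (rule exE)
  then have "(g has_real_derivative D) (at x)"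
    by (rule has_field_derivative_transform_within_open[OF _ J x eq])
  then show ?thesis
    unfolding real_differentiable_def by (rule exI)
qed

lemma deriv_funpow_cong_open:
  assumes "open J" "\<And>x. x \<in> J \<Longrightarrow> f x = g x" "x \<in> J"
  shows "(deriv ^^ k) f x = (deriv ^^ k) g x"
  using assms(3)
proof (induction k arbitrary: x)
  case (Suc k)
  then show ?case using deriv_cong_open[OF assms(1), of "(deriv ^^ k) f"] by simp
qed (use assms in auto)

lemma diff_upto_cong:
  assumes J: "open J" and eq: "\<And>x. x \<in> J \<Longrightarrow> f x = g x" and f: "diff_upto k J f"
  shows "diff_upto k J g"
  unfolding diff_upto_def
proof (intro allI impI ballI)
  fix i x assume i: "i \<le> k" and x: "x \<in> J"
  have "(deriv ^^ i) f differentiable (at x)"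
    using f i x unfolding diff_upto_def by simp
  moreover have "(deriv ^^ i) f y = (deriv ^^ i) g y" if "y \<in> J" for y
    by (rule deriv_funpow_cong_open[OF J eq that])
  ultimately show "(deriv ^^ i) g differentiable (at x)"
    using differentiable_cong_open[OF J, of "(deriv ^^ i) f" "(deriv ^^ i) g" x] x by simp
qed

lemma diff_upto_SucI:
  assumes "open J" "\<And>x. x \<in> J \<Longrightarrow> (f has_real_derivative g x) (at x)" "diff_upto k J g"
  shows "diff_upto (Suc k) J f"
proof -
  have "g x = deriv f x" if "x \<in> J" for x
    using DERIV_imp_deriv[OF assms(2)[OF that]] by simp
  then have "diff_upto k J (deriv f)"
    by (rule diff_upto_cong[OF assms(1) _ assms(3)])
  moreover have "f differentiable (at x)" if "x \<in> J" for x
    using assms(2)[OF that] unfolding real_differentiable_def by (rule exI)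
  ultimately show ?thesis
    unfolding diff_upto_Suc by simp
qed

text \<open>
  If \<open>f' = g\<close> and \<open>g\<close> is as often differentiable as \<open>f\<close>, as when \<open>g\<close> is a polynomial in \<open>f\<close> and smooth
  functions, then \<open>f\<close> is smooth.
\<close>

lemma smooth_on_bootstrap:
  assumes J: "open J" and d: "\<And>x. x \<in> J \<Longrightarrow> (f has_real_derivative g x) (at x)"
    and step: "\<And>k. diff_upto k J f \<Longrightarrow> diff_upto k J g"
  shows "smooth_on J f"
proof -
  have "diff_upto k J f" for k
  proof (induction k)
    case 0
    have "f differentiable (at x)" if "x \<in> J" for x
      using d[OF that] unfolding real_differentiable_def by (rule exI)
    then show ?case unfolding diff_upto_0 by (rule ballI)
  next
    case (Suc k)
    show ?case by (rule diff_upto_SucI[OF J d step[OF Suc]])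
  qed
  then show ?thesis unfolding smooth_on_iff by (rule allI)
qed

lemma diff_upto_const: "diff_upto k J (\<lambda>_. c)"
proof (induction k arbitrary: c)
  case (Suc k)
  have "deriv (\<lambda>_. c) = (\<lambda>_. 0 :: real)" by (intro ext DERIV_imp_deriv DERIV_const)
  with Suc show ?case by (simp add: diff_upto_Suc)
qed (simp add: diff_upto_0)

lemma diff_upto_add:
  assumes J: "open J" and "diff_upto k J f" "diff_upto k J g"
  shows "diff_upto k J (\<lambda>x. f x + g x)"
  using assms(2,3)
proof (induction k arbitrary: f g)
  case 0
  then show ?case by (simp add: diff_upto_0)
next
  case (Suc k)
  show ?case
  proof (rule diff_upto_SucI[OF J])
    show "((\<lambda>x. f x + g x) has_real_derivative deriv f x + deriv g x) (at x)" if "x \<in> J" for x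
      by (intro DERIV_add diff_upto_has_deriv[OF Suc.prems(1) that] diff_upto_has_deriv[OF Suc.prems(2) that])
    show "diff_upto k J (\<lambda>x. deriv f x + deriv g x)"
      using Suc.prems by (intro Suc.IH) (simp_all only: diff_upto_Suc)
  qed
qed

lemma diff_upto_mult:
  assumes J: "open J" and "diff_upto k J f" "diff_upto k J g"
  shows "diff_upto k J (\<lambda>x. f x * g x)"
  using assms(2,3)
proof (induction k arbitrary: f g)
  case 0
  then show ?case by (simp add: diff_upto_0)
next
  case (Suc k)
  show ?case
  proof (rule diff_upto_SucI[OF J])
    show "((\<lambda>x. f x * g x) has_real_derivative deriv f x * g x + deriv g x * f x) (at x)"
      if "x \<in> J" for x
      by (intro DERIV_mult diff_upto_has_deriv[OF Suc.prems(1) that] diff_upto_has_deriv[OF Suc.prems(2) that])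
    have "diff_upto k J (deriv f)" "diff_upto k J (deriv g)"
      using Suc.prems by (simp_all only: diff_upto_Suc)
    then show "diff_upto k J (\<lambda>x. deriv f x * g x + deriv g x * f x)"
      by (intro diff_upto_add[OF J] Suc.IH diff_upto_SucD[OF Suc.prems(1)] diff_upto_SucD[OF Suc.prems(2)])
  qed
qed

lemma smooth_on_has_deriv:
  "smooth_on J f \<Longrightarrow> x \<in> J \<Longrightarrow> (f has_real_derivative deriv f x) (at x)"
  by (rule diff_upto_has_deriv[of 0]) (simp_all only: smooth_on_iff)

lemma smooth_on_subset: "smooth_on J f \<Longrightarrow> J' \<subseteq> J \<Longrightarrow> smooth_on J' f"
  by (auto simp: smooth_on_def)

lemma smooth_on_deriv: "smooth_on J f \<Longrightarrow> smooth_on J (deriv f)"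
  unfolding smooth_on_iff
proof
  assume f: "\<forall>k. diff_upto k J f"
  show "diff_upto k J (deriv f)" for k
    using f[THEN spec, of "Suc k"] unfolding diff_upto_Suc by blast
qed

lemma smooth_on_const: "smooth_on J (\<lambda>_. c)"
  by (simp add: smooth_on_iff diff_upto_const)

lemma smooth_on_add:
  "open J \<Longrightarrow> smooth_on J f \<Longrightarrow> smooth_on J g \<Longrightarrow> smooth_on J (\<lambda>x. f x + g x)"
  by (simp add: smooth_on_iff diff_upto_add)

lemma smooth_on_mult:
  "open J \<Longrightarrow> smooth_on J f \<Longrightarrow> smooth_on J g \<Longrightarrow> smooth_on J (\<lambda>x. f x * g x)"
  by (simp add: smooth_on_iff diff_upto_mult)

lemma smooth_on_power: "open J \<Longrightarrow> smooth_on J f \<Longrightarrow> smooth_on J (\<lambda>x. f x ^ k)"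
  by (induction k) (simp_all add: smooth_on_const smooth_on_mult)

lemma smooth_on_sum:
  assumes "open J" "\<And>i. i \<in> S \<Longrightarrow> smooth_on J (f i)"
  shows "smooth_on J (\<lambda>x. \<Sum>i\<in>S. f i x)"
  using assms(2) by (induction S rule: infinite_finite_induct) (simp_all add: smooth_on_const smooth_on_add assms(1))

lemma smooth_on_inverse:
  assumes J: "open J" and f: "smooth_on J f" "\<And>x. x \<in> J \<Longrightarrow> f x \<noteq> 0"
  shows "smooth_on J (\<lambda>x. inverse (f x))"
proof (rule smooth_on_bootstrap[OF J])
  show "((\<lambda>x. inverse (f x)) has_real_derivative (-1) * deriv f x * (inverse (f x) * inverse (f x))) (at x)"
    if "x \<in> J" for x
    using smooth_on_has_deriv[OF f(1) that] f(2)[OF that]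
    by (auto intro!: derivative_eq_intros)
  show "diff_upto k J (\<lambda>x. (-1) * deriv f x * (inverse (f x) * inverse (f x)))"
    if "diff_upto k J (\<lambda>x. inverse (f x))" for k
    using that smooth_on_deriv[OF f(1)]
    by (intro diff_upto_mult[OF J] diff_upto_const) (auto simp: smooth_on_iff)
qed

lemma smooth_on_shift: "open J \<Longrightarrow> smooth_on J (\<lambda>t. t - c)"
  by (rule smooth_on_bootstrap[where g = "\<lambda>_. 1"])
     (auto intro!: derivative_eq_intros diff_upto_const)

text \<open>
  The Taylor series at \<open>x\<close>, as a formal series. On smooth functions it is a homomorphism of
  differential rings, so that the identities for power series apply to functions.
\<close>

definition jet :: "real \<Rightarrow> (real \<Rightarrow> real) \<Rightarrow> real fps" where
  "jet x f = Abs_fps (\<lambda>k. (deriv ^^ k) f x / fact k)"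

lemma nth_0_jet: "(fps_deriv ^^ k) (jet x f) $ 0 = (deriv ^^ k) f x"
  by (simp add: jet_def nth_0_fps_deriv_Abs_fps)

lemma jet_nth_0 [simp]: "jet x f $ 0 = f x"
  by (simp add: jet_def)

lemma jet_deriv: "jet x (deriv f) = fps_deriv (jet x f)"
  by (rule fps_ext) (simp add: jet_def funpow_swap1)

lemma jet_cong:
  assumes "open J" "\<And>x. x \<in> J \<Longrightarrow> f x = g x" "x \<in> J"
  shows "jet x f = jet x g"
  unfolding jet_def using deriv_funpow_cong_open[OF assms] by simp

lemma jet_const: "jet x (\<lambda>_. c) = fps_const c"
proof -
  have 0: "deriv (\<lambda>_. c) = (\<lambda>_. 0 :: real)" for c :: real by (intro ext DERIV_imp_deriv DERIV_const)
  have "(deriv ^^ k) (\<lambda>_. c) x = (if k = 0 then c else 0)" for k c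
    by (induction k arbitrary: c) (simp_all add: funpow_Suc_right 0 del: funpow.simps(2))
  then show ?thesis by (intro fps_ext) (simp add: jet_def)
qed

lemma jet_add:
  assumes "open J" "x \<in> J" "smooth_on J f" "smooth_on J g"
  shows "jet x (\<lambda>x. f x + g x) = jet x f + jet x g"
proof (rule fps_ext)
  show "jet x (\<lambda>x. f x + g x) $ k = (jet x f + jet x g) $ k" for k
    using assms(3,4)
  proof (induction k arbitrary: f g)
    case (Suc k)
    have "jet x (deriv (\<lambda>x. f x + g x)) = jet x (\<lambda>x. deriv f x + deriv g x)"
      using Suc.prems by (intro jet_cong[OF assms(1) _ assms(2)] DERIV_imp_deriv DERIV_add smooth_on_has_deriv)
    then have "fps_deriv (jet x (\<lambda>x. f x + g x)) $ k = fps_deriv (jet x f + jet x g) $ k"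
      using Suc.IH[of "deriv f" "deriv g"] Suc.prems
      by (simp only: jet_deriv[symmetric] fps_deriv_add smooth_on_deriv)
    then show ?case by (simp del: of_nat_Suc add: distrib_left[symmetric])
  qed simp
qed

text \<open>
  Equality of the coefficients \<open>k + 1\<close> is equality of the coefficients \<open>k\<close> of the derivatives; the
  claim follows by induction from the product rule for one derivative.
\<close>

lemma jet_mult:
  assumes "open J" "x \<in> J" "smooth_on J f" "smooth_on J g"
  shows "jet x (\<lambda>x. f x * g x) = jet x f * jet x g"
proof (rule fps_ext)
  show "jet x (\<lambda>x. f x * g x) $ k = (jet x f * jet x g) $ k" for k
    using assms(3,4)
  proof (induction k arbitrary: f g)
    case (Suc k)
    have "jet x (deriv (\<lambda>x. f x * g x)) = jet x (\<lambda>x. f x * deriv g x + deriv f x * g x)"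
      using Suc.prems
      by (intro jet_cong[OF assms(1) _ assms(2)] DERIV_imp_deriv)
         (auto intro!: derivative_eq_intros dest: smooth_on_has_deriv)
    also have "\<dots> = jet x (\<lambda>x. f x * deriv g x) + jet x (\<lambda>x. deriv f x * g x)"
      using Suc.prems by (intro jet_add[OF assms(1,2)] smooth_on_mult assms(1) smooth_on_deriv)
    also have "\<dots> $ k = (jet x f * jet x (deriv g) + jet x (deriv f) * jet x g) $ k"
      using Suc.IH[of f "deriv g"] Suc.IH[of "deriv f" g] Suc.prems by (simp add: smooth_on_deriv)
    finally have "fps_deriv (jet x (\<lambda>x. f x * g x)) $ k = fps_deriv (jet x f * jet x g) $ k"
      by (simp only: jet_deriv fps_deriv_mult)
    then show ?case by (simp only: fps_deriv_nth) simp
  qed simp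
qed

lemma jet_Psi:
  assumes J: "open J" and x: "x \<in> J" and sm: "smooth_on J r" "smooth_on J s" "smooth_on J y"
  shows "smooth_on J (Psi r s y)"
    and "jet x (Psi r s y) = psi_fps (jet x r) (jet x s) (jet x y)"
proof -
  have sm': "smooth_on J (\<lambda>x. r x * deriv y x)" "smooth_on J (\<lambda>x. s x * y x)"
    by (intro smooth_on_mult J sm smooth_on_deriv)+
  show "smooth_on J (Psi r s y)"
    unfolding Psi_def by (rule smooth_on_add[OF J sm'])
  show "jet x (Psi r s y) = psi_fps (jet x r) (jet x s) (jet x y)"
    unfolding Psi_def psi_fps_def jet_deriv[symmetric]
    by (simp add: jet_add[OF J x sm'] jet_mult[OF J x] sm smooth_on_deriv)
qed

lemma jet_Psi_funpow:
  assumes "open J" "x \<in> J" "smooth_on J r" "smooth_on J s" "smooth_on J y"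
  shows "smooth_on J ((Psi r s ^^ k) y) \<and>
         jet x ((Psi r s ^^ k) y) = (psi_fps (jet x r) (jet x s) ^^ k) (jet x y)"
  by (induction k) (simp_all add: jet_Psi[OF assms(1-4)] assms(5))

lemma jet_shift: "jet x (\<lambda>t. t - x) = fps_X"
proof -
  have "deriv (\<lambda>t. t - x) = (\<lambda>_. 1)"
    by (intro ext DERIV_imp_deriv) (auto intro!: derivative_eq_intros)
  then have "fps_deriv (jet x (\<lambda>t. t - x)) = 1"
    by (simp add: jet_deriv[symmetric] jet_const)
  then have "fps_deriv (jet x (\<lambda>t. t - x)) = fps_deriv fps_X" by simp
  then show ?thesis
    by (subst (asm) fps_deriv_eq_iff) simp
qed

lemma jet_shift_power: "jet x (\<lambda>t. (t - x) ^ k) = fps_X ^ k"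
proof (induction k)
  case (Suc k)
  then show ?case
    by (simp add: jet_mult[OF open_UNIV] smooth_on_shift smooth_on_power jet_shift)
qed (simp add: jet_const)

lemma ex_polynomial_jet:
  "\<exists>p. smooth_on UNIV p \<and> (\<forall>k\<le>n. (deriv ^^ k) p x = c k)"
proof -
  define p where "p n t = (\<Sum>k\<le>n. c k / fact k * (t - x) ^ k)" for n t
  have sm: "smooth_on UNIV (\<lambda>t. c k / fact k * (t - x) ^ k)" for k
    by (intro smooth_on_mult smooth_on_const smooth_on_power smooth_on_shift open_UNIV)
  have smp: "smooth_on UNIV (p n)" for n
    unfolding p_def by (intro smooth_on_sum open_UNIV sm)
  have jet1: "jet x (\<lambda>t. c k / fact k * (t - x) ^ k) = fps_const (c k / fact k) * fps_X ^ k" for k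
    by (simp only: jet_mult[OF open_UNIV UNIV_I] smooth_on_const smooth_on_shift smooth_on_power
         open_UNIV jet_shift_power jet_const)
  have "jet x (p n) = (\<Sum>k\<le>n. fps_const (c k / fact k) * fps_X ^ k)"
  proof (induction n)
    case 0
    then show ?case using jet1[of 0] by (simp add: p_def)
  next
    case (Suc n)
    have "p (Suc n) = (\<lambda>t. p n t + c (Suc n) / fact (Suc n) * (t - x) ^ Suc n)"
      by (simp add: p_def fun_eq_iff)
    then have "jet x (p (Suc n)) = jet x (p n) + fps_const (c (Suc n) / fact (Suc n)) * fps_X ^ Suc n"
      using jet_add[OF open_UNIV UNIV_I smp sm] by (simp only: jet1)
    then show ?case using Suc by simp
  qed
  then have "(deriv ^^ k) (p n) x = c k" if "k \<le> n" for k
    using that unfolding nth_0_jet[symmetric]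
    by (simp add: fps_0th_higher_deriv fps_sum_nth fps_X_power_nth if_distrib[of "\<lambda>u. _ * u"] sum.delta cong: if_cong)
  then show ?thesis using smp by blast
qed

section \<open>Local solutions of the Riccati equation\<close>

text \<open>
  The integral operator \<open>a \<mapsto> - \<integral>\<^sub>c (q + a\<^sup>2)\<close> maps the unit ball of the bounded continuous functions to
  itself and contracts it when the interval is short. The value \<open>0\<close> is prescribed at the left end \<open>c\<close> of the
  interval and not at \<open>x0\<close>, so that only integrals over \<open>{c..x}\<close> occur.
\<close>

lemma ex_riccati_solution:
  fixes q :: "real \<Rightarrow> real"
  assumes J: "open J" "x0 \<in> J" and q: "continuous_on J q"
  shows "\<exists>c d a. c < x0 \<and> x0 < d \<and> {c..d} \<subseteq> J \<and> continuous_on {c..d} a \<and>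
           (\<forall>x\<in>{c<..<d}. (a has_real_derivative - q x - a x * a x) (at x))"
proof -
  obtain e where e: "e > 0" "cball x0 e \<subseteq> J"
    using J open_contains_cball by blast
  have qc: "continuous_on (cball x0 e) q"
    using q e continuous_on_subset by blast
  obtain K where K: "\<And>x. x \<in> cball x0 e \<Longrightarrow> \<bar>q x\<bar> \<le> K"
    using compact_imp_bounded[OF compact_continuous_image[OF qc compact_cball]]
    unfolding bounded_iff real_norm_def by blast
  have K0: "K \<ge> 0" using K[of x0] e by (simp add: abs_le_iff) 
  \<comment> \<open>On the unit ball \<open>\<bar>q + a\<^sup>2\<bar> \<le> K + 1\<close> and \<open>a \<mapsto> a\<^sup>2\<close> has Lipschitz constant \<open>2\<close>.\<close>
  define \<delta> where "\<delta> = min e (1 / (8 * (K + 1)))"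
  define c where "c = x0 - \<delta>"
  define d where "d = x0 + \<delta>"
  have \<delta>: "\<delta> > 0" "\<delta> \<le> e" "\<delta> \<le> 1 / (8 * (K + 1))"
    using e K0 by (auto simp: \<delta>_def)
  have len: "(K + 1) * (d - c) \<le> 1 / 4" "2 * (d - c) \<le> 1 / 2"
  proof -
    show a: "(K + 1) * (d - c) \<le> 1 / 4"
      using \<delta>(3) K0 by (simp add: c_def d_def field_simps)
    have "1 * (d - c) \<le> (K + 1) * (d - c)"
      using K0 \<delta> by (intro mult_right_mono) (auto simp: c_def d_def)
    then show "2 * (d - c) \<le> 1 / 2" using a by linarith
  qed
  have cd: "c < x0" "x0 < d" "{c..d} \<subseteq> cball x0 e"
    using \<delta> by (auto simp: c_def d_def dist_real_def)
  have qcd: "continuous_on {c..d} q"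
    using qc cd continuous_on_subset by blast
  \<comment> \<open>Bounded continuous functions live on the whole line; the projection extends constantly.\<close>
  define P :: "real \<Rightarrow> real" where "P x = max c (min d x)" for x
  have P: "P x \<in> {c..d}" "x \<in> {c..d} \<Longrightarrow> P x = x" for x
    using cd by (auto simp: P_def)
  define T where "T a = (\<lambda>x. - integral {c..P x} (\<lambda>t. q t + apply_bcontfun a t * apply_bcontfun a t))" for a
  define S :: "(real \<Rightarrow>\<^sub>C real) set" where "S = PiC UNIV (\<lambda>_. {-1..1})"
  have SD: "\<bar>apply_bcontfun a x\<bar> \<le> 1" if "a \<in> S" for a x
  proof -
    have "apply_bcontfun a x \<in> {-1..1}"
      using that unfolding S_def mem_PiC_iff Pi_iff by blast
    then show ?thesis by (simp add: abs_le_iff)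
  qed
  have cont: "continuous_on X (\<lambda>t. apply_bcontfun a t * apply_bcontfun b t)" for X and a b :: "real \<Rightarrow>\<^sub>C real"
    by (intro continuous_on_mult continuous_on_apply_bcontfun)
  have contq: "continuous_on {c..d} (\<lambda>t. q t + apply_bcontfun a t * apply_bcontfun a t)" for a
    by (intro continuous_on_add qcd cont)
  have contq': "continuous_on {c..P x} (\<lambda>t. q t + apply_bcontfun a t * apply_bcontfun a t)" for a x
    using P(1)[of x] by (intro continuous_on_subset[OF contq]) auto
  have Tcont: "continuous_on UNIV (T a)" for a
  proof -
    have cP: "continuous_on UNIV P"
      unfolding P_def by (intro continuous_intros)
    have cI: "continuous_on {c..d} (\<lambda>x. integral {c..x} (\<lambda>t. q t + apply_bcontfun a t * apply_bcontfun a t))"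
      by (intro indefinite_integral_continuous_1 integrable_continuous_real contq)
    have "P ` UNIV \<subseteq> {c..d}"
      using P(1) by (rule image_subsetI)
    then show ?thesis
      unfolding T_def by (rule continuous_on_minus[OF continuous_on_compose2[OF cI cP]])
  qed
  have Tb: "\<bar>T a x\<bar> \<le> 1" if "a \<in> S" for a x
  proof -
    have "norm (q t + apply_bcontfun a t * apply_bcontfun a t) \<le> K + 1" if "t \<in> {c..P x}" for t
    proof -
      have "t \<in> {c..d}" using that P(1)[of x] by simp
      then have "\<bar>q t\<bar> \<le> K" using cd(3) by (intro K) (rule subsetD)
      moreover have "\<bar>apply_bcontfun a t * apply_bcontfun a t\<bar> \<le> 1"
        unfolding abs_mult using SD[OF \<open>a \<in> S\<close>, of t] by (intro mult_le_one) simp_all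
      ultimately show ?thesis
        unfolding real_norm_def by (rule order_trans[OF abs_triangle_ineq add_mono])
    qed
    then have "norm (integral {c..P x} (\<lambda>t. q t + apply_bcontfun a t * apply_bcontfun a t)) \<le> (K + 1) * (P x - c)"
      using P(1)[of x] by (intro integral_bound contq') auto
    also have "\<dots> \<le> (K + 1) * (d - c)"
      using P(1)[of x] K0 by (intro mult_left_mono) auto
    finally show ?thesis using len by (simp add: T_def)
  qed
  have Tbc: "T a \<in> bcontfun" if "a \<in> S" for a
    using Tb[OF that] Tcont by (intro bcontfun_normI[where b = 1]) auto
  have Tap: "apply_bcontfun (Bcontfun (T a)) = T a" if "a \<in> S" for a
    using Tbc[OF that] by (simp add: Bcontfun_inverse)
  have "\<exists>!a\<in>S. Bcontfun (T a) = a"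
  proof (rule Banach_fix[where c = "1/2"])
    show "complete S"
      unfolding S_def complete_eq_closed by (rule closed_PiC) simp
    have "0 \<in> S" by (simp add: S_def mem_PiC_iff)
    then show "S \<noteq> {}" by blast
    show "(\<lambda>a. Bcontfun (T a)) ` S \<subseteq> S"
    proof safe
      fix a assume a: "a \<in> S"
      have "T a x \<in> {-1..1}" for x using Tb[OF a, of x] by (auto simp: abs_le_iff)
      then show "Bcontfun (T a) \<in> S"
        unfolding S_def by (intro mem_PiCI) (auto simp only: Tap[OF a])
    qed
    fix a b assume ab: "a \<in> S" "b \<in> S"
    show "dist (Bcontfun (T a)) (Bcontfun (T b)) \<le> 1/2 * dist a b"
    proof (rule dist_bound)
      fix x
      have "norm (apply_bcontfun b t * apply_bcontfun b t - apply_bcontfun a t * apply_bcontfun a t) \<le> 2 * dist a b" for t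
      proof -
        have "apply_bcontfun b t * apply_bcontfun b t - apply_bcontfun a t * apply_bcontfun a t
          = (apply_bcontfun b t + apply_bcontfun a t) * (apply_bcontfun b t - apply_bcontfun a t)"
          by (simp add: algebra_simps)
        moreover have "\<bar>apply_bcontfun b t + apply_bcontfun a t\<bar> \<le> 2"
          using SD[OF ab(1), of t] SD[OF ab(2), of t] by linarith
        moreover have "\<bar>apply_bcontfun b t - apply_bcontfun a t\<bar> \<le> dist a b"
          using dist_bounded[of a t b] by (simp add: dist_real_def abs_minus_commute)
        ultimately show ?thesis by (simp add: abs_mult mult_mono)
      qed
      then have "norm (integral {c..P x} (\<lambda>t. apply_bcontfun b t * apply_bcontfun b t - apply_bcontfun a t * apply_bcontfun a t))
          \<le> (2 * dist a b) * (P x - c)"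
        using P(1)[of x] by (intro integral_bound continuous_on_diff cont) auto
      also have "\<dots> \<le> (2 * dist a b) * (d - c)"
        using P(1)[of x] by (intro mult_left_mono) auto
      also have "\<dots> = dist a b * (2 * (d - c))" by simp
      also have "\<dots> \<le> dist a b * (1/2)"
        using len by (intro mult_left_mono) auto
      also have "integral {c..P x} (\<lambda>t. apply_bcontfun b t * apply_bcontfun b t - apply_bcontfun a t * apply_bcontfun a t)
         = T a x - T b x"
      proof -
        have "T a x - T b x = integral {c..P x} (\<lambda>t. (q t + apply_bcontfun b t * apply_bcontfun b t) - (q t + apply_bcontfun a t * apply_bcontfun a t))"
          by (subst integral_diff) (auto simp: T_def intro!: integrable_continuous_real contq')
        then show ?thesis by simp
      qed
      finally show "dist (apply_bcontfun (Bcontfun (T a)) x) (apply_bcontfun (Bcontfun (T b)) x) \<le> 1/2 * dist a b"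
        by (simp add: Tap ab dist_real_def)
    qed
  qed auto
  then obtain a where a: "a \<in> S" "Bcontfun (T a) = a" by blast
  then have fp: "apply_bcontfun a = T a" using Tap by metis
  have "(apply_bcontfun a has_real_derivative - q x - apply_bcontfun a x * apply_bcontfun a x) (at x)"
    if x: "x \<in> {c<..<d}" for x
  proof -
    have "((\<lambda>x. integral {c..x} (\<lambda>t. q t + apply_bcontfun a t * apply_bcontfun a t)) has_real_derivative
        q x + apply_bcontfun a x * apply_bcontfun a x) (at x within {c..d})"
      using x by (intro integral_has_real_derivative contq) simp
    then have "((\<lambda>x. integral {c..x} (\<lambda>t. q t + apply_bcontfun a t * apply_bcontfun a t)) has_real_derivative
        q x + apply_bcontfun a x * apply_bcontfun a x) (at x)"
      using x by (simp add: at_within_Icc_at)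
    then have "((\<lambda>x. - integral {c..x} (\<lambda>t. q t + apply_bcontfun a t * apply_bcontfun a t)) has_real_derivative
        - (q x + apply_bcontfun a x * apply_bcontfun a x)) (at x)"
      by (rule DERIV_minus)
    then have "(T a has_real_derivative - (q x + apply_bcontfun a x * apply_bcontfun a x)) (at x)"
      by (rule has_field_derivative_transform_within_open[where S = "{c<..<d}"])
         (use x P(2) in \<open>auto simp: T_def\<close>)
    then show ?thesis by (simp add: fp[symmetric])
  qed
  moreover have "continuous_on {c..d} (apply_bcontfun a)" by simp
  ultimately show ?thesis using cd e by (metis order_trans)
qed

section \<open>Iterative equations in normal form\<close>

text \<open>
  The coefficient of \<open>f\<^bsup>(i)\<^esup>\<close> in \<open>\<Psi>\<^sup>k f\<close> for arbitrary \<open>r\<close> and \<open>s\<close>. Besides the leading coefficient, only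
  that of the second highest derivative is computed, since normal form requires it to vanish.
\<close>

primrec psicoeff :: "real fps \<Rightarrow> real fps \<Rightarrow> nat \<Rightarrow> nat \<Rightarrow> real fps" where
  "psicoeff r s 0 i = (if i = 0 then 1 else 0)"
| "psicoeff r s (Suc k) i =
     r * (fps_deriv (psicoeff r s k i) + (if i = 0 then 0 else psicoeff r s k (i - 1))) + s * psicoeff r s k i"

lemma psicoeff_gt: "k < i \<Longrightarrow> psicoeff r s k i = 0"
  by (induction k arbitrary: i) auto

lemma psicoeff_same: "psicoeff r s k k = r ^ k"
  by (induction k) (simp_all add: psicoeff_gt)

lemma psicoeff_pred:
  "psicoeff r s (Suc k) k = of_nat (Suc k) * r ^ k * (s + fps_const (real k / 2) * fps_deriv r)"
proof (induction k)
  case (Suc k)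
  have D: "fps_deriv (r ^ Suc k) = of_nat (Suc k) * fps_deriv r * r ^ k"
    by (simp only: fps_deriv_power' diff_Suc_1)
  have "real (Suc (Suc k)) * (real (Suc k) / 2) = real (Suc k) + real (Suc k) * (real k / 2)"
    by (simp add: field_simps)
  then have key: "of_nat (Suc (Suc k)) * fps_const (real (Suc k) / 2)
      = of_nat (Suc k) + of_nat (Suc k) * fps_const (real k / 2)"
    by (simp only: fps_of_nat[symmetric] fps_const_mult fps_const_add)
  have two: "of_nat (Suc (Suc k)) = of_nat (Suc k) + (1 :: real fps)"
    by simp
  have "psicoeff r s (Suc (Suc k)) (Suc k)
      = r * (fps_deriv (r ^ Suc k) + psicoeff r s (Suc k) k) + s * r ^ Suc k"
    by (simp add: psicoeff_same del: psicoeff.simps(2) add: psicoeff.simps(2)[of r s "Suc k" "Suc k"])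
  also have "\<dots> = of_nat (Suc (Suc k)) * r ^ Suc k * (s + fps_const (real (Suc k) / 2) * fps_deriv r)"
  proof -
    have "of_nat (Suc (Suc k)) * r ^ Suc k * (s + fps_const (real (Suc k) / 2) * fps_deriv r)
        = of_nat (Suc (Suc k)) * r ^ Suc k * s
          + (of_nat (Suc (Suc k)) * fps_const (real (Suc k) / 2)) * r ^ Suc k * fps_deriv r"
      by (simp only: algebra_simps)
    then show ?thesis
      unfolding D Suc key
      unfolding two power_Suc by (simp only: algebra_simps mult_1_left mult_1_right)
  qed
  finally show ?case .
qed simp

lemma psi_fps_funpow_eq_sum:
  "(psi_fps r s ^^ k) f = (\<Sum>i\<le>k. psicoeff r s k i * (fps_deriv ^^ i) f)"
proof (induction k)
  case (Suc k)
  have "(psi_fps r s ^^ Suc k) f = r * fps_deriv (\<Sum>i\<le>k. psicoeff r s k i * (fps_deriv ^^ i) f)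
      + s * (\<Sum>i\<le>Suc k. psicoeff r s k i * (fps_deriv ^^ i) f)"
    by (simp add: Suc psi_fps_def psicoeff_gt)
  also have "\<dots> = (\<Sum>i\<le>Suc k. psicoeff r s (Suc k) i * (fps_deriv ^^ i) f)"
    unfolding fps_deriv_sum_coeffs[of "psicoeff r s k", OF psicoeff_gt[OF lessI]]
      sum_distrib_left sum.distrib[symmetric] psicoeff.simps(2)
    by (intro sum.cong refl) (simp add: distrib_right mult.assoc)
  finally show ?case .
qed simp

lemma psi_fps_funpow_X_power:
  "(psi_fps r s ^^ Suc k) (fps_X ^ k) $ 0
     = fact k * (real (Suc k) * (r $ 0) ^ k * (s $ 0 + real k / 2 * r $ 1))"
proof -
  have "(psi_fps r s ^^ Suc k) (fps_X ^ k) $ 0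
     = (\<Sum>i\<le>Suc k. psicoeff r s (Suc k) i $ 0 * (if i = k then fact k else 0))"
    unfolding psi_fps_funpow_eq_sum fps_sum_nth fps_mult_nth_0 fps_0th_higher_deriv
    by (intro sum.cong refl) (simp add: fps_X_power_nth)
  also have "\<dots> = psicoeff r s (Suc k) k $ 0 * fact k"
    by (simp add: if_distrib[of "\<lambda>u. _ * u"] sum.delta cong: if_cong del: sum.atMost_Suc psicoeff.simps(2))
  also have "\<dots> = fact k * (real (Suc k) * (r $ 0) ^ k * (s $ 0 + real k / 2 * r $ 1))"
    unfolding psicoeff_pred by (simp add: fps_of_nat[symmetric] fps_power_zeroth)
  finally show ?thesis .
qed

lemma operator_of_Theta_coeff:
  "operator_of n (Theta_coeff n) q y x = symop (real n - 1) (jet x q) n (jet x y) $ 0"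
  by (simp add: operator_of_def symop_nth_0 nth_0_jet)

lemma Psi_funpow_eq_operator_of:
  assumes J: "open J" and sm: "smooth_on J r" "smooth_on J a" "smooth_on J q"
    and r: "\<And>x. x \<in> J \<Longrightarrow> deriv r x = 2 * a x * r x"
    and a: "\<And>x. x \<in> J \<Longrightarrow> deriv a x = (-1) * q x + (-1) * (a x * a x)"
    and s: "\<And>x. x \<in> J \<Longrightarrow> s x = - (real n - 1) / 2 * deriv r x" "smooth_on J s"
    and y: "smooth_on J y" and x: "x \<in> J"
  shows "(Psi r s ^^ n) y x = r x ^ n * operator_of n (Theta_coeff n) q y x"
proof -
  note rules = jet_mult[OF J x] jet_add[OF J x] jet_const smooth_on_mult smooth_on_add
    smooth_on_const sm J smooth_on_deriv
  have "jet x (deriv r) = jet x (\<lambda>x. 2 * a x * r x)"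
    by (rule jet_cong[OF J r x])
  then have jr: "fps_deriv (jet x r) = fps_const 2 * jet x a * jet x r"
    by (simp add: rules jet_deriv)
  have "jet x (deriv a) = jet x (\<lambda>x. (-1) * q x + (-1) * (a x * a x))"
    by (rule jet_cong[OF J a x])
  also have "\<dots> = fps_const (-1) * jet x q + fps_const (-1) * (jet x a * jet x a)"
    by (simp only: rules)
  finally have ja: "fps_deriv (jet x a) = - jet x q - (jet x a)\<^sup>2"
    by (simp add: jet_deriv power2_eq_square del: fps_const_neg flip: fps_const_neg)
  have "jet x s = jet x (\<lambda>x. - (real n - 1) / 2 * deriv r x)"
    by (rule jet_cong[OF J s(1) x])
  then have js: "jet x s = fps_const (- (real n - 1) / 2) * fps_deriv (jet x r)"
    by (simp only: rules jet_deriv)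
  have "(Psi r s ^^ n) y x = jet x ((Psi r s ^^ n) y) $ 0" by simp
  also have "jet x ((Psi r s ^^ n) y) = (psi_fps (jet x r) (jet x s) ^^ n) (jet x y)"
    using jet_Psi_funpow[OF J x sm(1) s(2) y] by blast
  also have "\<dots> = jet x r ^ n * symop (real n - 1) (jet x q) n (jet x y)"
    unfolding js by (rule psi_fps_funpow_eq_symop[OF jr ja])
  finally show ?thesis
    by (simp add: operator_of_Theta_coeff fps_power_zeroth)
qed

text \<open>
  The function \<open>(t - x)\<^sup>n\<^sup>-\<^sup>1\<close> extracts at \<open>x\<close> the coefficient of the derivative of order \<open>n - 1\<close>. It
  is \<open>0\<close> in normal form, and \<open>n r\<^sup>n\<^sup>-\<^sup>1 (s + (n - 1) r' / 2)\<close> for \<open>\<Psi>\<^sup>n\<close>.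
\<close>

lemma iterative_normal_form_imp_s:
  assumes J: "open J" and sm: "smooth_on J r" "smooth_on J s" and r: "\<And>x. x \<in> J \<Longrightarrow> r x \<noteq> 0"
    and eq: "same_equation J (normal_form n A) (Psi r s ^^ n)" and x: "x \<in> J" and n: "n \<ge> 1"
  shows "s x = - (real n - 1) / 2 * deriv r x"
proof -
  obtain k where k: "n = Suc k" using n by (cases n) auto
  define y where "y = (\<lambda>t. (t - x) ^ k)"
  have y: "smooth_on J y"
    unfolding y_def by (intro smooth_on_power smooth_on_shift J)
  have dy: "(deriv ^^ i) y x = (if i = k then fact k else 0)" for i
    unfolding nth_0_jet[symmetric] y_def jet_shift_power fps_0th_higher_deriv
    by (simp add: fps_X_power_nth)
  have "normal_form n A y x = 0"
    unfolding normal_form_def dy using k by (auto intro!: sum.neutral)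
  moreover obtain m where "m x \<noteq> 0" "normal_form n A y x = m x * (Psi r s ^^ n) y x"
    using eq x y unfolding same_equation_def by blast
  ultimately have "(Psi r s ^^ n) y x = 0" by simp
  moreover have "(Psi r s ^^ n) y x = (psi_fps (jet x r) (jet x s) ^^ n) (jet x y) $ 0"
    using jet_Psi_funpow[OF J x sm y, of n] jet_nth_0 by metis
  moreover have "jet x y = fps_X ^ k"
    unfolding y_def by (rule jet_shift_power)
  ultimately have "(psi_fps (jet x r) (jet x s) ^^ Suc k) (fps_X ^ k) $ 0 = 0"
    by (simp only: k)
  then have "s x + real k / 2 * jet x r $ 1 = 0"
    unfolding psi_fps_funpow_X_power using r[OF x] by simp
  moreover have "jet x r $ 1 = deriv r x" by (simp add: jet_def)
  ultimately show ?thesis using k by (simp add: field_simps)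
qed

lemma iterative_imp_operator_of:
  assumes J: "open J" and n: "n \<ge> 1" and it: "iterative J n (normal_form n A)"
  shows "\<exists>q. smooth_on J q \<and> same_equation J (normal_form n A) (operator_of n (Theta_coeff n) q)"
proof -
  obtain r s where sm: "smooth_on J r" "smooth_on J s" and r: "\<And>x. x \<in> J \<Longrightarrow> r x \<noteq> 0"
    and eq: "same_equation J (normal_form n A) (Psi r s ^^ n)"
    using it unfolding iterative_def by blast
  obtain m where m: "smooth_on J m" "\<And>x. x \<in> J \<Longrightarrow> m x \<noteq> 0"
    "\<And>y x. smooth_on J y \<Longrightarrow> x \<in> J \<Longrightarrow> normal_form n A y x = m x * (Psi r s ^^ n) y x"
    using eq unfolding same_equation_def by blast
  define a where "a = (\<lambda>x. 1 / 2 * (deriv r x * inverse (r x)))"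
  define q where "q = (\<lambda>x. (-1) * deriv a x + (-1) * (a x * a x))"
  have a: "smooth_on J a"
    unfolding a_def by (intro smooth_on_mult smooth_on_const smooth_on_deriv smooth_on_inverse J sm r)
  then have q: "smooth_on J q"
    unfolding q_def by (intro smooth_on_add smooth_on_mult smooth_on_const smooth_on_deriv J)
  have "normal_form n A y x = (m x * r x ^ n) * operator_of n (Theta_coeff n) q y x"
    if "smooth_on J y" "x \<in> J" for y x
  proof -
    have "(Psi r s ^^ n) y x = r x ^ n * operator_of n (Theta_coeff n) q y x"
    proof (rule Psi_funpow_eq_operator_of[OF J sm(1) a q _ _ _ sm(2) that])
      fix x assume x: "x \<in> J"
      show "deriv r x = 2 * a x * r x" using r[OF x] by (simp add: a_def)
      show "deriv a x = (-1) * q x + (-1) * (a x * a x)" by (simp add: q_def)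
      show "s x = - (real n - 1) / 2 * deriv r x"
        by (rule iterative_normal_form_imp_s[OF J sm r eq x n])
    qed
    then show ?thesis using m(3)[OF that] by simp
  qed
  moreover have "smooth_on J (\<lambda>x. m x * r x ^ n)"
    by (intro smooth_on_mult smooth_on_power m sm J)
  moreover have "\<forall>x\<in>J. m x * r x ^ n \<noteq> 0" using m r by simp
  ultimately have "same_equation J (normal_form n A) (operator_of n (Theta_coeff n) q)"
    unfolding same_equation_def by (intro exI[of _ "\<lambda>x. m x * r x ^ n"]) blast
  with q show ?thesis by blast
qed

lemma normal_form_cong:
  assumes "\<And>k. k \<le> n \<Longrightarrow> (deriv ^^ k) y x = (deriv ^^ k) p x"
  shows "normal_form n A y x = normal_form n A p x"
  unfolding normal_form_def using assms by (intro arg_cong2[of _ _ _ _ "(+)"] sum.cong) simp_all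

lemma operator_of_cong:
  assumes "\<And>k. k \<le> n \<Longrightarrow> (deriv ^^ k) y x = (deriv ^^ k) p x"
  shows "operator_of n B q y x = operator_of n B q p x"
  unfolding operator_of_def using assms by (intro sum.cong) simp_all

text \<open>
  A smooth function on the smaller interval need not extend to the larger one. Both operators depend
  only on the derivatives up to order \<open>n\<close> at the point, so its Taylor polynomial can be used
  instead.
\<close>

lemma same_equation_subset:
  assumes "same_equation J (normal_form n A) (operator_of n B q)" "J' \<subseteq> J"
  shows "same_equation J' (normal_form n A) (operator_of n B q)"
proof -
  obtain m where m: "smooth_on J m" "\<And>x. x \<in> J \<Longrightarrow> m x \<noteq> 0"
    "\<And>y x. smooth_on J y \<Longrightarrow> x \<in> J \<Longrightarrow> normal_form n A y x = m x * operator_of n B q y x"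
    using assms(1) unfolding same_equation_def by blast
  have "normal_form n A y x = m x * operator_of n B q y x" if "x \<in> J'" for y x
  proof -
    obtain p where p: "smooth_on UNIV p" "\<And>k. k \<le> n \<Longrightarrow> (deriv ^^ k) p x = (deriv ^^ k) y x"
      using ex_polynomial_jet[of n x "\<lambda>k. (deriv ^^ k) y x"] by blast
    have "normal_form n A p x = m x * operator_of n B q p x"
      using m(3) smooth_on_subset[OF p(1)] that assms(2) by blast
    then show ?thesis
      using normal_form_cong[of n p x y A] operator_of_cong[of n p x y B q] p(2) by simp
  qed
  moreover have "smooth_on J' m" "\<forall>x\<in>J'. m x \<noteq> 0"
    using m assms(2) smooth_on_subset by blast+
  ultimately show ?thesis unfolding same_equation_def by blast
qed

text \<open>
  With \<open>a\<close> a solution of the Riccati equation, \<open>r = exp (2 \<integral> a)\<close> is the square of a solution \<open>u\<close> of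
  \<open>u'' + q u = 0\<close> without zeros.
\<close>

lemma ex_local_r:
  assumes J: "open J" "x0 \<in> J" and q: "smooth_on J q"
  shows "\<exists>J' a r. open_interval J' \<and> x0 \<in> J' \<and> J' \<subseteq> J \<and> smooth_on J' a \<and> smooth_on J' r \<and>
     (\<forall>x\<in>J'. r x \<noteq> 0 \<and> deriv r x = 2 * a x * r x \<and> deriv a x = (-1) * q x + (-1) * (a x * a x))"
proof -
  have "continuous_on J q"
    using smooth_on_has_deriv[OF q] by (meson DERIV_isCont continuous_at_imp_continuous_on)
  then obtain c d a where cd: "c < x0" "x0 < d" "{c..d} \<subseteq> J" and ac: "continuous_on {c..d} a"
    and a: "\<And>x. x \<in> {c<..<d} \<Longrightarrow> (a has_real_derivative - q x - a x * a x) (at x)"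
    using ex_riccati_solution[OF J] by blast
  define J' where "J' = {c<..<d}"
  have J': "open J'" "J' \<subseteq> J" "open_interval J'" "x0 \<in> J'"
    using cd by (auto simp: J'_def open_interval_def is_interval_oo)
  have q': "smooth_on J' q" using q J' smooth_on_subset by blast
  have da: "(a has_real_derivative (-1) * q x + (-1) * (a x * a x)) (at x)" if "x \<in> J'" for x
    using a[of x] that by (simp add: J'_def)
  have sa: "smooth_on J' a"
    by (rule smooth_on_bootstrap[OF J'(1) da], assumption)
       (intro diff_upto_add diff_upto_mult diff_upto_const J'(1), use q' in \<open>simp_all add: smooth_on_iff\<close>)
  define r where "r = (\<lambda>x. exp (2 * integral {c..x} a))"
  have dr: "(r has_real_derivative 2 * a x * r x) (at x)" if x: "x \<in> J'" for x
  proof -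
    have "((\<lambda>x. integral {c..x} a) has_real_derivative a x) (at x within {c..d})"
      using x by (intro integral_has_real_derivative ac) (auto simp: J'_def)
    then have "((\<lambda>x. integral {c..x} a) has_real_derivative a x) (at x)"
      using x by (simp add: at_within_Icc_at J'_def)
    then show ?thesis
      unfolding r_def by (auto intro!: derivative_eq_intros)
  qed
  have sr: "smooth_on J' r"
    by (rule smooth_on_bootstrap[OF J'(1) dr], assumption)
       (intro diff_upto_mult diff_upto_const J'(1), use sa in \<open>simp_all add: smooth_on_iff\<close>)
  have "r x \<noteq> 0" for x by (simp add: r_def)
  moreover have "deriv r x = 2 * a x * r x" "deriv a x = (-1) * q x + (-1) * (a x * a x)" if "x \<in> J'" for x
    using DERIV_imp_deriv[OF dr[OF that]] DERIV_imp_deriv[OF da[OF that]] by simp_all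
  ultimately show ?thesis using J' sa sr by blast
qed

lemma operator_of_imp_iterative:
  assumes J: "open J" "x0 \<in> J" and q: "smooth_on J q"
    and eq: "same_equation J (normal_form n A) (operator_of n (Theta_coeff n) q)"
  shows "\<exists>J'. open_interval J' \<and> x0 \<in> J' \<and> J' \<subseteq> J \<and> iterative J' n (normal_form n A)"
proof -
  obtain J' a r where J': "open_interval J'" "x0 \<in> J'" "J' \<subseteq> J"
    and sm: "smooth_on J' a" "smooth_on J' r"
    and r: "\<And>x. x \<in> J' \<Longrightarrow> r x \<noteq> 0" "\<And>x. x \<in> J' \<Longrightarrow> deriv r x = 2 * a x * r x"
    and a: "\<And>x. x \<in> J' \<Longrightarrow> deriv a x = (-1) * q x + (-1) * (a x * a x)"
    using ex_local_r[OF J q] by blast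
  have o: "open J'" using J' by (simp add: open_interval_def)
  have q': "smooth_on J' q" using q J' smooth_on_subset by blast
  define s where "s = (\<lambda>x. - (real n - 1) / 2 * deriv r x)"
  have s: "smooth_on J' s"
    unfolding s_def by (intro smooth_on_mult smooth_on_const smooth_on_deriv o sm)
  obtain m where m: "smooth_on J' m" "\<And>x. x \<in> J' \<Longrightarrow> m x \<noteq> 0"
    "\<And>y x. smooth_on J' y \<Longrightarrow> x \<in> J' \<Longrightarrow> normal_form n A y x = m x * operator_of n (Theta_coeff n) q y x"
    using same_equation_subset[OF eq J'(3)] unfolding same_equation_def by blast
  have "normal_form n A y x = (m x * inverse (r x) ^ n) * (Psi r s ^^ n) y x"
    if y: "smooth_on J' y" and x: "x \<in> J'" for y x
  proof -
    have "(Psi r s ^^ n) y x = r x ^ n * operator_of n (Theta_coeff n) q y x"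
      by (rule Psi_funpow_eq_operator_of[OF o sm(2,1) q' r(2) a _ s y x]) (simp_all add: s_def)
    then show ?thesis
      using m(3)[OF y x] r(1)[OF x] by (simp add: field_simps)
  qed
  moreover have "smooth_on J' (\<lambda>x. m x * inverse (r x) ^ n)"
    by (intro smooth_on_mult smooth_on_power smooth_on_inverse m sm o r)
  moreover have "\<forall>x\<in>J'. m x * inverse (r x) ^ n \<noteq> 0" using m r by simp
  ultimately have "same_equation J' (normal_form n A) (Psi r s ^^ n)"
    unfolding same_equation_def by (intro exI[of _ "\<lambda>x. m x * inverse (r x) ^ n"]) blast
  then have "iterative J' n (normal_form n A)"
    unfolding iterative_def using sm s r by blast
  with J' show ?thesis by blast
qed

theorem mainTheorem5:
  fixes n :: nat
  assumes "n \<ge> 2"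
  shows "\<exists>B :: nat \<Rightarrow> nat dexpr.
    (\<forall>\<rho> :: dvar \<Rightarrow> real. \<rho> (U, 0) \<noteq> 0 \<longrightarrow>
       dval \<rho> (Theta_expr n) = (\<Sum>j\<le>n. dval (\<lambda>k. \<rho> (Q, k)) (B j) * \<rho> (Y, n - j))) \<and>
    (\<forall>\<tau>. dval \<tau> (B 0) = 1) \<and> (\<forall>\<tau>. dval \<tau> (B 1) = 0) \<and>
    (\<forall>I x0 A. open_interval I \<longrightarrow> x0 \<in> I \<longrightarrow> (\<forall>j\<in>{2..n}. smooth_on I (A j)) \<longrightarrow>
       ((\<exists>J. open_interval J \<and> x0 \<in> J \<and> J \<subseteq> I \<and> iterative J n (normal_form n A)) \<longleftrightarrow>
        (\<exists>J q. open_interval J \<and> x0 \<in> J \<and> J \<subseteq> I \<and> smooth_on J q \<and>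
               same_equation J (normal_form n A) (operator_of n B q))))"
proof (intro exI[of _ "Theta_coeff n"] conjI allI impI)
  fix \<rho> :: "dvar \<Rightarrow> real"
  assume "\<rho> (U, 0) \<noteq> 0"
  then show "dval \<rho> (Theta_expr n) = (\<Sum>j\<le>n. dval (\<lambda>k. \<rho> (Q, k)) (Theta_coeff n j) * \<rho> (Y, n - j))"
    by (rule dval_Theta_expr)
next
  show "dval \<tau> (Theta_coeff n 0) = 1" for \<tau> by (rule dval_Theta_coeff_0)
  show "dval \<tau> (Theta_coeff n 1) = 0" for \<tau> using assms by (intro dval_Theta_coeff_1) simp
next
  fix I x0 and A :: "nat \<Rightarrow> real \<Rightarrow> real"
  show "(\<exists>J. open_interval J \<and> x0 \<in> J \<and> J \<subseteq> I \<and> iterative J n (normal_form n A)) \<longleftrightarrow>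
        (\<exists>J q. open_interval J \<and> x0 \<in> J \<and> J \<subseteq> I \<and> smooth_on J q \<and>
               same_equation J (normal_form n A) (operator_of n (Theta_coeff n) q))"
    (is "?iter \<longleftrightarrow> ?oper")
  proof
    assume ?iter
    then obtain J where J: "open_interval J" "x0 \<in> J" "J \<subseteq> I" "iterative J n (normal_form n A)"
      by blast
    then show ?oper
      using iterative_imp_operator_of[of J n A] assms unfolding open_interval_def by auto
  next
    assume ?oper
    then obtain J q where "open_interval J" "x0 \<in> J" "J \<subseteq> I" "smooth_on J q"
      "same_equation J (normal_form n A) (operator_of n (Theta_coeff n) q)"
      by blast
    then show ?iter
      using operator_of_imp_iterative[of J x0 q n A] unfolding open_interval_def by (meson subset_trans)
  qed
qed

end
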